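(* Let $h\ge 4$ be an integer and, for each $m\ge 1$, let $M_m$ denote the meta-chain of length $m$ all of whose cycles have $h$ vertices. Write $p_m=i(P_m;x)$ and put $$\alpha=x^2\,p_{h-5}+x\,(p_{h-4}+2p_{h-5})+p_{h-4},$$ $$\beta=x\,p_{h-5}^2+p_{h-5}^2+p_{h-4}\,p_{h-5}-p_{h-4}\,p_{h-6}.$$ Then for every $n\ge 3$, $$i(M_n;x)=\alpha\cdot i(M_{n-1};x)-x^2\cdot\beta\cdot i(M_{n-2};x).$$
   Context: All graphs are finite and simple. The independence polynomial of a graph $G$ is $i(G;x)=\sum_{k=0}^{\alpha(G)}\Psi_k(G)x^k$, where $\Psi_k(G)$ is the number of independent sets of $G$ with exactly $k$ vertices and $\alpha(G)$ is the independence number (largest size of an independent set); the symbol $\alpha$ without argument in the claim is the polynomial defined there. $P_m$ is the path on $m$ vertices, for which $i(P_m;x)=\sum_{k=0}^{\lfloor (m+1)/2\rfloor}\binom{m+1-k}{k}x^k$. This formula is used also for small indices, giving $i(P_0;x)=1$, $i(P_{-1};x)=1$ and $i(P_{-2};x)=0$ (empty sum). A cactus is a connected graph in which each edge lies in at most one cycle. A chain cactus is a cactus in which each block is a cycle containing at most two cut vertices and each cut vertex is contained in exactly two cycles; its length is the number of its cycles. A chain $h$-cactus is a chain cactus all of whose cycles have exactly $h$ vertices. In a chain cactus of length $n$ the cycles are denoted $C^{(1)},\dots,C^{(n)}$ in their order along the chain (consecutive cycles share one cut vertex). Internal cycles are $C^{(2)},\dots,C^{(n-1)}$; each contains exactly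 two cut vertices. An internal cycle is in $k$-position if its two cut vertices are at distance $k$ (in the cycle); $2$-position is called meta-position. The meta-chain $M_n$ is the chain $h$-cactus of length $n$ (unique up to isomorphism) all of whose internal cycles are in meta-position; $M_1$ is the cycle $C_h$, and $M_2$ is two $h$-cycles sharing one vertex. *)

theory Defs
  imports
    "HOL-Computational_Algebra.Polynomial"
    "Graph_Theory.Digraph_Component"
begin

text \<open>
  A finite simple graph is a \<^locale>\<open>pair_graph\<close>: a finite vertex set with a symmetric, irreflexive
  set of arcs, the edge \<open>uv\<close> being represented by the two arcs \<open>(u, v)\<close> and \<open>(v, u)\<close>.
\<close>

definition indep_set :: "'a pair_pre_digraph \<Rightarrow> 'a set \<Rightarrow> bool" where
  "indep_set G S \<longleftrightarrow> S \<subseteq> pverts G \<and> (\<forall>u\<in>S. \<forall>v\<in>S. (u, v) \<notin> parcs G)"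

definition indep_count :: "'a pair_pre_digraph \<Rightarrow> nat \<Rightarrow> nat" where
  "indep_count G k = card {S. indep_set G S \<and> card S = k}"

definition indep_number :: "'a pair_pre_digraph \<Rightarrow> nat" where
  "indep_number G = Max {card S | S. indep_set G S}"

definition indep_poly :: "'a pair_pre_digraph \<Rightarrow> int poly" where
  "indep_poly G = (\<Sum>k=0..indep_number G. monom (int (indep_count G k)) k)"

definition path_graph :: "nat \<Rightarrow> nat pair_pre_digraph" where
  "path_graph m = \<lparr>pverts = {..<m},
     parcs = {(i, j). i < m \<and> j < m \<and> (j = Suc i \<or> i = Suc j)}\<rparr>"

text \<open>
  For indices \<open>m \<le> 0\<close>, the closed formula for the independence polynomial of the path on \<open>m\<close> vertices
  serves as the definition; \<open>div\<close> on \<^typ>\<open>int\<close> rounds down, so the sum is empty for \<open>m = -2\<close>.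
\<close>

definition path_poly :: "int \<Rightarrow> int poly" where
  "path_poly m =
     (if m \<ge> 1 then indep_poly (path_graph (nat m))
      else (\<Sum>k=0..(m + 1) div 2. monom (int (nat (m + 1 - k) choose nat k)) (nat k)))"

lemma path_poly_small:
  "path_poly 0 = 1" "path_poly (-1) = 1" "path_poly (-2) = 0"
  by (simp_all add: path_poly_def monom_0 one_pCons)

definition cut_vertex :: "'a pair_pre_digraph \<Rightarrow> 'a \<Rightarrow> bool" where
  "cut_vertex G v \<longleftrightarrow> v \<in> pverts G \<and>
     (\<exists>x \<in> pverts G - {v}. \<exists>y \<in> pverts G - {v}.
        x \<rightarrow>\<^sup>*\<^bsub>G\<^esub> y \<and> \<not> x \<rightarrow>\<^sup>*\<^bsub>pre_digraph.del_vert G v\<^esub> y)"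

definition nonseparable :: "'a pair_pre_digraph \<Rightarrow> bool" where
  "nonseparable B \<longleftrightarrow> pair_graph B \<and> connected B \<and> (\<forall>v. \<not> cut_vertex B v)"

definition block :: "'a pair_pre_digraph \<Rightarrow> 'a pair_pre_digraph \<Rightarrow> bool" where
  "block G B \<longleftrightarrow> subgraph B G \<and> nonseparable B \<and>
     (\<forall>B'. nonseparable B' \<and> subgraph B' G \<and> subgraph B B' \<longrightarrow> B' = B)"

text \<open>
  The bound on the length excludes the closed walks \<open>u, v, u\<close> along a single edge, which are cycles
  in the sense of \<^const>\<open>pre_digraph.cycle\<close>. A cycle is identified with the graph it forms, so it does
  not depend on a starting point or an orientation.
\<close>

definition cycle_graph :: "'a pair_pre_digraph \<Rightarrow> bool" where
  "cycle_graph C \<longleftrightarrow> (\<exists>p. pre_digraph.cycle C p \<and> length p \<ge> 3 \<and>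
     pverts C = fst ` set p \<and> parcs C = set p \<union> (set p)\<inverse>)"

definition cycles_of :: "'a pair_pre_digraph \<Rightarrow> 'a pair_pre_digraph set" where
  "cycles_of G = {C. cycle_graph C \<and> subgraph C G}"

definition cactus :: "'a pair_pre_digraph \<Rightarrow> bool" where
  "cactus G \<longleftrightarrow> pair_graph G \<and> connected G \<and>
     (\<forall>e \<in> parcs G. \<forall>C \<in> cycles_of G. \<forall>D \<in> cycles_of G. e \<in> parcs C \<and> e \<in> parcs D \<longrightarrow> C = D)"

definition cut_vertices_in :: "'a pair_pre_digraph \<Rightarrow> 'a pair_pre_digraph \<Rightarrow> 'a set" where
  "cut_vertices_in G C = {v \<in> pverts C. cut_vertex G v}"

definition chain_cactus :: "'a pair_pre_digraph \<Rightarrow> bool" where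
  "chain_cactus G \<longleftrightarrow> cactus G \<and>
     (\<forall>B. block G B \<longrightarrow> cycle_graph B \<and> card (cut_vertices_in G B) \<le> 2) \<and>
     (\<forall>v. cut_vertex G v \<longrightarrow> card {C \<in> cycles_of G. v \<in> pverts C} = 2)"

definition chain_h_cactus :: "nat \<Rightarrow> 'a pair_pre_digraph \<Rightarrow> bool" where
  "chain_h_cactus h G \<longleftrightarrow> chain_cactus G \<and> (\<forall>C \<in> cycles_of G. card (pverts C) = h)"

definition chain_length :: "'a pair_pre_digraph \<Rightarrow> nat" where
  "chain_length G = card (cycles_of G)"

text \<open>
  Lists count from \<open>0\<close>: the \<open>i\<close>-th cycle of the chain is \<open>Cs ! (i - 1)\<close>. Up to reversal, a chain
  cactus has exactly one such list.
\<close>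

definition chain_order :: "'a pair_pre_digraph \<Rightarrow> 'a pair_pre_digraph list \<Rightarrow> bool" where
  "chain_order G Cs \<longleftrightarrow> distinct Cs \<and> set Cs = cycles_of G \<and>
     (\<forall>i. Suc i < length Cs \<longrightarrow>
        (\<exists>v. cut_vertex G v \<and> pverts (Cs ! i) \<inter> pverts (Cs ! Suc i) = {v}))"

definition graph_dist :: "'a pair_pre_digraph \<Rightarrow> 'a \<Rightarrow> 'a \<Rightarrow> nat" where
  "graph_dist G u v = (LEAST k. \<exists>p. pre_digraph.awalk G u p v \<and> length p = k)"

definition in_position :: "'a pair_pre_digraph \<Rightarrow> nat \<Rightarrow> 'a pair_pre_digraph \<Rightarrow> bool" where
  "in_position G k C \<longleftrightarrow>
     (\<exists>u v. u \<noteq> v \<and> cut_vertices_in G C = {u, v} \<and> graph_dist C u v = k)"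

definition meta_chain :: "nat \<Rightarrow> nat \<Rightarrow> 'a pair_pre_digraph \<Rightarrow> bool" where
  "meta_chain h n G \<longleftrightarrow> chain_h_cactus h G \<and> chain_length G = n \<and>
     (\<exists>Cs. chain_order G Cs \<and> (\<forall>i. 0 < i \<and> i < n - 1 \<longrightarrow> in_position G 2 (Cs ! i)))"

end

theory Submission
  imports Defs
begin

text \<open>
  In a chain cactus every block is a cycle, so the graph is the union of its cycles. Consecutive
  cycles meet in one cut vertex, and two other cycles are disjoint: a ring of cycles would be a
  nonseparable subgraph, hence part of a single block. A meta-chain is therefore built by gluing
  cycles one after the other, the next one at distance two from the previous cut vertex.

  For a chain of \<open>m\<close> cycles with a marked vertex at distance two from the last cut vertex, let
  \<open>a\<^sub>m\<close> and \<open>b\<^sub>m\<close> be the generating polynomials, by cardinality, of the independent sets avoiding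
  and containing the marked vertex. Conditioning on the cut vertex at which a cycle is glued leaves
  only paths, and \<open>(a\<^sub>m, b\<^sub>m)\<close> is multiplied by a
  \<open>2 \<times> 2\<close> matrix that depends on \<open>h\<close> alone. By Cayley-Hamilton, \<open>a\<^sub>m + b\<^sub>m\<close> satisfies the recurrence
  given by the trace \<open>\<alpha>\<close> and the determinant \<open>x\<^sup>2 \<beta>\<close> of this matrix.
\<close>

subsection \<open>Independence polynomials of vertex sets\<close>

text \<open>The relation stays fixed while the vertex set shrinks, so deleting vertices never
  changes the ambient graph. One monomial per independent set suits bijective arguments better than
  counting by size.\<close>

definition indep_poly_on :: "'a rel \<Rightarrow> 'a set \<Rightarrow> int poly" where
  "indep_poly_on E V = (\<Sum>S | S \<subseteq> V \<and> (\<forall>u\<in>S. \<forall>v\<in>S. (u, v) \<notin> E). monom 1 (card S))"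

text \<open>Grouping the independent sets by cardinality gives the coefficients; finiteness makes
  the \<open>Max\<close> in \<open>indep_number\<close> a genuine bound on these
  cardinalities.\<close>

lemma indep_poly_eq_on_verts:
  assumes "finite (pverts G)"
  shows "indep_poly G = indep_poly_on (parcs G) (pverts G)"
proof -
  let ?A = "{S. indep_set G S}"
  have fin: "finite ?A"
    by (rule finite_subset[of _ "Pow (pverts G)"]) (use assms in \<open>auto simp: indep_set_def\<close>)
  have "card ` ?A \<subseteq> {0..indep_number G}"
  proof
    fix k assume "k \<in> card ` ?A"
    then have "k \<in> {card S | S. indep_set G S}" by auto
    moreover have "finite {card S | S. indep_set G S}"
      using fin by (simp add: setcompr_eq_image)
    ultimately show "k \<in> {0..indep_number G}" by (simp add: indep_number_def)
  qed
  from sum.group[OF fin _ this, of "\<lambda>S. monom (1::int) (card S)"]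
  have "(\<Sum>S\<in>?A. monom (1::int) (card S)) =
      (\<Sum>k=0..indep_number G. \<Sum>S | S \<in> ?A \<and> card S = k. monom 1 (card S))"
    by simp
  also have "\<dots> = (\<Sum>k=0..indep_number G. monom (int (indep_count G k)) k)"
    by (rule sum.cong) (auto simp: indep_count_def of_nat_monom mult_monom)
  finally show ?thesis
    by (simp add: indep_poly_def indep_poly_on_def indep_set_def)
qed

lemma indep_poly_on_empty [simp]: "indep_poly_on E {} = 1"
proof -
  have "{S. S \<subseteq> {} \<and> (\<forall>u\<in>S. \<forall>v\<in>S. (u, v) \<notin> E)} = {{}}" by auto
  then show ?thesis by (simp add: indep_poly_on_def)
qed

text \<open>The independent sets containing \<open>v\<close> arise by inserting \<open>v\<close>
  into those that avoid \<open>v\<close> and its neighbours, at the cost of one factor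
  \<open>x\<close>.\<close>

lemma indep_poly_on_delete:
  assumes "finite V" "v \<in> V" "sym E" "(v, v) \<notin> E"
  shows "indep_poly_on E V = indep_poly_on E (V - {v}) + monom 1 1 * indep_poly_on E (V - {v} - E `` {v})"
proof -
  let ?I = "\<lambda>W. {S. S \<subseteq> W \<and> (\<forall>u\<in>S. \<forall>v\<in>S. (u, v) \<notin> E)}"
  have fin: "finite (?I W)" if "W \<subseteq> V" for W
    by (rule finite_subset[of _ "Pow V"]) (use assms that in auto)
  have img: "?I V = ?I (V - {v}) \<union> insert v ` ?I (V - {v} - E `` {v})" (is "_ = _ \<union> ?J")
  proof (intro equalityI subsetI)
    fix S assume S: "S \<in> ?I V"
    show "S \<in> ?I (V - {v}) \<union> ?J"
    proof (cases "v \<in> S")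
      case True
      then have "S = insert v (S - {v})" by auto
      moreover have "S - {v} \<in> ?I (V - {v} - E `` {v})" using S True by auto
      ultimately show ?thesis by blast
    qed (use S in auto)
  next
    fix S assume "S \<in> ?I (V - {v}) \<union> ?J"
    then show "S \<in> ?I V" using assms by (fastforce dest: symD)
  qed
  have inj: "inj_on (insert v) (?I (V - {v} - E `` {v}))"
    by (rule inj_onI) (auto dest: insert_ident[THEN iffD1, rotated 2])
  have "indep_poly_on E V = indep_poly_on E (V - {v}) + (\<Sum>S\<in>?J. monom 1 (card S))"
    unfolding indep_poly_on_def img
    by (rule sum.union_disjoint) (auto intro!: fin finite_imageI)
  also have "(\<Sum>S\<in>?J. monom (1::int) (card S)) =
      (\<Sum>S\<in>?I (V - {v} - E `` {v}). monom 1 (card (insert v S)))"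
    by (simp add: sum.reindex[OF inj])
  also have "\<dots> = (\<Sum>S\<in>?I (V - {v} - E `` {v}). monom 1 1 * monom 1 (card S))"
  proof (rule sum.cong)
    fix S assume S: "S \<in> ?I (V - {v} - E `` {v})"
    then have "S \<subseteq> V" by auto
    then have "finite S" "v \<notin> S" using S assms(1) finite_subset by auto
    then show "monom 1 (card (insert v S)) = monom 1 1 * monom (1::int) (card S)"
      by (simp add: mult_monom)
  qed simp
  finally show ?thesis by (simp add: indep_poly_on_def sum_distrib_left)
qed

text \<open>With no arcs between the parts, an independent set is a free choice of one in each part,
  and cardinalities add up in the exponent.\<close>

lemma indep_poly_on_union:
  assumes "finite V" "finite W" "V \<inter> W = {}"
    and "\<And>v w. v \<in> V \<Longrightarrow> w \<in> W \<Longrightarrow> (v, w) \<notin> E \<and> (w, v) \<notin> E"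
  shows "indep_poly_on E (V \<union> W) = indep_poly_on E V * indep_poly_on E W"
proof -
  let ?I = "\<lambda>W. {S. S \<subseteq> W \<and> (\<forall>u\<in>S. \<forall>v\<in>S. (u, v) \<notin> E)}"
  have inj: "inj_on (\<lambda>(S, T). S \<union> T) (?I V \<times> ?I W)"
  proof (rule inj_onI, clarsimp)
    fix S T S' T' assume a: "S \<subseteq> V" "S' \<subseteq> V" "T \<subseteq> W" "T' \<subseteq> W" "S \<union> T = S' \<union> T'"
    have "S = (S \<union> T) \<inter> V" "T = (S \<union> T) \<inter> W" "S' = (S' \<union> T') \<inter> V" "T' = (S' \<union> T') \<inter> W"
      using a(1-4) assms(3) by auto
    then show "S = S' \<and> T = T'" using a(5) by metis
  qed
  have img: "?I (V \<union> W) = (\<lambda>(S, T). S \<union> T) ` (?I V \<times> ?I W)"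
  proof (intro equalityI subsetI)
    fix S assume S: "S \<in> ?I (V \<union> W)"
    then have "S = (\<lambda>(S, T). S \<union> T) (S \<inter> V, S \<inter> W)" by auto
    moreover have "(S \<inter> V, S \<inter> W) \<in> ?I V \<times> ?I W" using S by auto
    ultimately show "S \<in> (\<lambda>(S, T). S \<union> T) ` (?I V \<times> ?I W)" by blast
  next
    fix S assume "S \<in> (\<lambda>(S, T). S \<union> T) ` (?I V \<times> ?I W)"
    then obtain A B where "S = A \<union> B" "A \<in> ?I V" "B \<in> ?I W" by auto
    then show "S \<in> ?I (V \<union> W)" using assms(4) by blast
  qed
  have "indep_poly_on E (V \<union> W) = (\<Sum>(S, T)\<in>?I V \<times> ?I W. monom 1 (card (S \<union> T)))"
    unfolding indep_poly_on_def img by (subst sum.reindex[OF inj]) (auto intro!: sum.cong)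
  also have "\<dots> = (\<Sum>(S, T)\<in>?I V \<times> ?I W. monom 1 (card S) * monom 1 (card T))"
  proof (rule sum.cong, simp, clarify)
    fix S T assume "S \<subseteq> V" "T \<subseteq> W"
    then have "card (S \<union> T) = card S + card T"
      using assms(1-3) by (intro card_Un_disjoint) (auto intro: finite_subset)
    then show "monom (1::int) (card (S \<union> T)) = monom 1 (card S) * monom 1 (card T)"
      by (simp add: mult_monom)
  qed
  also have "\<dots> = indep_poly_on E V * indep_poly_on E W"
    by (simp add: indep_poly_on_def sum_product sum.cartesian_product)
  finally show ?thesis .
qed

section \<open>Independence polynomials of induced paths\<close>

fun path_rec :: "nat \<Rightarrow> int poly" where
  "path_rec 0 = 1"
| "path_rec (Suc 0) = 1 + monom 1 1"
| "path_rec (Suc (Suc m)) = path_rec (Suc m) + monom 1 1 * path_rec m"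

text \<open>An induced path inside a possibly larger relation \<open>E\<close>. Integer labels with
  arbitrary start \<open>a\<close> let any proper arc of a periodically labelled cycle qualify
  without relabelling.\<close>

definition path_labelling :: "'a rel \<Rightarrow> (int \<Rightarrow> 'a) \<Rightarrow> int \<Rightarrow> nat \<Rightarrow> bool" where
  "path_labelling E c a m \<longleftrightarrow> (\<forall>i\<in>{a..<a + int m}. \<forall>j\<in>{a..<a + int m}.
     (c i = c j \<longrightarrow> i = j) \<and> ((c i, c j) \<in> E \<longleftrightarrow> j = i + 1 \<or> i = j + 1))"

lemma indep_poly_on_path:
  assumes "sym E" "path_labelling E c a m"
  shows "indep_poly_on E (c ` {a..<a + int m}) = path_rec m"
  using assms(2)
proof (induction m rule: path_rec.induct)
  case 2
  have "{a..<a + int (Suc 0)} = {a}" by auto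
  then show ?case using 2 indep_poly_on_delete[of "{c a}" "c a" E] assms(1) by (simp add: path_labelling_def)
next
  case (3 m)
  \<comment> \<open>\<open>?l\<close> is the last label. Its only neighbour on the path is the label
    before it, so deleting \<open>?l\<close> leaves \<open>m + 1\<close> labels and deleting its
    neighbour as well leaves \<open>m\<close>.\<close>
  let ?V = "c ` {a..<a + int (Suc (Suc m))}" and ?l = "a + int m + 1"
  have l: "?l \<in> {a..<a + int (Suc (Suc m))}" by simp
  have P: "\<And>i j. i \<in> {a..<a + int (Suc (Suc m))} \<Longrightarrow> j \<in> {a..<a + int (Suc (Suc m))} \<Longrightarrow>
     (c i = c j \<longrightarrow> i = j) \<and> ((c i, c j) \<in> E \<longleftrightarrow> j = i + 1 \<or> i = j + 1)"
    using "3.prems" unfolding path_labelling_def by blast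
  have "path_labelling E c a (Suc m)" "path_labelling E c a m"
    using P unfolding path_labelling_def by auto
  note IH = "3.IH"(1)[OF this(1)] "3.IH"(2)[OF this(2)]
  have eq1: "?V - {c ?l} = c ` {a..<a + int (Suc m)}"
  proof (intro equalityI subsetI)
    fix y assume "y \<in> ?V - {c ?l}"
    then obtain i where "i \<in> {a..<a + int (Suc (Suc m))}" "y = c i" "c i \<noteq> c ?l" by auto
    moreover from this have "i \<noteq> ?l" by auto
    ultimately show "y \<in> c ` {a..<a + int (Suc m)}" by auto
  next
    fix y assume "y \<in> c ` {a..<a + int (Suc m)}"
    then obtain i where i: "i \<in> {a..<a + int (Suc m)}" "y = c i" by auto
    then show "y \<in> ?V - {c ?l}" using P[of i ?l] l by auto
  qed
  have eq2: "c ` {a..<a + int (Suc m)} - E `` {c ?l} = c ` {a..<a + int m}"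
  proof (intro equalityI subsetI)
    fix y assume "y \<in> c ` {a..<a + int (Suc m)} - E `` {c ?l}"
    then obtain i where i: "i \<in> {a..<a + int (Suc m)}" "y = c i" "(c ?l, c i) \<notin> E" by auto
    then have "i \<noteq> a + int m" using P[of ?l i] l by auto
    then show "y \<in> c ` {a..<a + int m}" using i by auto
  next
    fix y assume "y \<in> c ` {a..<a + int m}"
    then obtain i where i: "i \<in> {a..<a + int m}" "y = c i" by auto
    then have "(c ?l, c i) \<notin> E" using P[of ?l i] l by auto
    then show "y \<in> c ` {a..<a + int (Suc m)} - E `` {c ?l}" using i by auto
  qed
  have "indep_poly_on E ?V = indep_poly_on E (?V - {c ?l}) + monom 1 1 * indep_poly_on E (?V - {c ?l} - E `` {c ?l})"
    by (rule indep_poly_on_delete) (use P[of ?l ?l] l assms(1) in auto)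
  then show ?case unfolding eq1 eq2 by (simp only: IH path_rec.simps)
qed simp

lemma path_poly_of_nat: "path_poly (int m) = path_rec m"
proof (cases "m = 0")
  case False
  let ?E = "parcs (path_graph m)"
  have "path_labelling ?E nat 0 m" by (auto simp: path_labelling_def path_graph_def)
  moreover have "sym ?E" by (auto simp: path_graph_def sym_def)
  ultimately have "indep_poly_on ?E (nat ` {0..<0 + int m}) = path_rec m" by (intro indep_poly_on_path)
  moreover have "nat ` {0..<0 + int m} = {..<m}"
    by (auto simp: image_iff intro!: bexI[of _ "int _"])
  ultimately show ?thesis
    using False by (simp add: path_poly_def indep_poly_eq_on_verts path_graph_def)
qed (simp add: path_poly_small)

text \<open>
  The vertices of a cycle are labelled periodically by all integers, so that rotating and reflecting
  the cycle become translation and negation of labels.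
\<close>

definition cyclic_labelling :: "'a rel \<Rightarrow> nat \<Rightarrow> (int \<Rightarrow> 'a) \<Rightarrow> bool" where
  "cyclic_labelling E h c \<longleftrightarrow> (\<forall>i j. (c i = c j \<longleftrightarrow> int h dvd i - j) \<and>
     ((c i, c j) \<in> E \<longleftrightarrow> int h dvd j - i - 1 \<or> int h dvd i - j - 1))"

lemma cyc_shift: "cyclic_labelling E h c \<Longrightarrow> cyclic_labelling E h (\<lambda>i. c (i + k))"
  by (simp add: cyclic_labelling_def)

lemma cyc_reflect:
  assumes "cyclic_labelling E h c"
  shows "cyclic_labelling E h (\<lambda>i. c (- i))"
  unfolding cyclic_labelling_def
proof (intro allI)
  fix i j :: int
  have eqs: "- i - - j = - (i - j)" "- j - - i - 1 = i - j - 1" "- i - - j - 1 = j - i - 1" by auto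
  have "(c (- i) = c (- j)) = (int h dvd - i - - j)"
    and "((c (- i), c (- j)) \<in> E) = (int h dvd - j - - i - 1 \<or> int h dvd - i - - j - 1)"
    using assms unfolding cyclic_labelling_def by blast+
  then show "(c (- i) = c (- j)) = (int h dvd i - j) \<and>
      ((c (- i), c (- j)) \<in> E) = (int h dvd j - i - 1 \<or> int h dvd i - j - 1)"
    unfolding eqs(2,3) unfolding eqs(1) dvd_minus_iff by blast
qed

lemma dvd_small_int: "\<lbrakk>int h dvd x; \<bar>x\<bar> < int h\<rbrakk> \<Longrightarrow> x = 0"
  by (rule ccontr) (use dvd_imp_le_int[of x "int h"] in simp)

lemma cyc_range:
  assumes "cyclic_labelling E h c" "h > 0"
  shows "range c = c ` {a..<a + int h}"
proof
  show "range c \<subseteq> c ` {a..<a + int h}"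
  proof
    fix y assume "y \<in> range c"
    then obtain i where i: "y = c i" by auto
    \<comment> \<open>\<open>?j\<close> is the representative of \<open>i\<close> modulo
      \<open>h\<close> in the window starting at \<open>a\<close>.\<close>
    let ?j = "a + (i - a) mod int h"
    have "int h dvd i - ?j" by (simp add: dvd_minus_mod flip: diff_diff_eq)
    then have "c i = c ?j" using assms by (simp add: cyclic_labelling_def)
    moreover have "?j \<in> {a..<a + int h}" using assms by simp
    ultimately show "y \<in> c ` {a..<a + int h}" using i by blast
  qed
qed auto

text \<open>With at most \<open>h - 1\<close> consecutive labels all relevant differences stay below
  \<open>h\<close> in absolute value, so divisibility by \<open>h\<close> means equality; a full
  window of \<open>h\<close> labels would contain the wrap-around edge.\<close>

lemma cyc_path_labelling:
  assumes "cyclic_labelling E h c" "m < h" "h \<ge> 3"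
  shows "path_labelling E c a m"
  unfolding path_labelling_def
proof (intro ballI)
  fix i j assume "i \<in> {a..<a + int m}" "j \<in> {a..<a + int m}"
  then have "\<bar>i - j\<bar> < int h" "\<bar>j - i - 1\<bar> < int h" "\<bar>i - j - 1\<bar> < int h" using assms by auto
  then have "int h dvd i - j \<longleftrightarrow> i - j = 0" "int h dvd j - i - 1 \<longleftrightarrow> j - i - 1 = 0"
    "int h dvd i - j - 1 \<longleftrightarrow> i - j - 1 = 0"
    using dvd_small_int[of h] by (metis dvd_0_right)+
  then show "(c i = c j \<longrightarrow> i = j) \<and> ((c i, c j) \<in> E \<longleftrightarrow> j = i + 1 \<or> i = j + 1)"
    using assms(1) unfolding cyclic_labelling_def by auto
qed

subsection \<open>The transfer recursion along a meta-chain\<close>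

text \<open>
  For \<open>h = 4\<close> the truncated index \<open>h - 5\<close> is \<open>0\<close>, which is harmless because \<open>i(P\<^sub>0) = i(P\<^sub>-\<^sub>1) = 1\<close>.
\<close>

fun meta_transfer :: "nat \<Rightarrow> nat \<Rightarrow> int poly \<times> int poly" where
  "meta_transfer h 0 = (path_rec (h - 1), monom 1 1 * path_rec (h - 3))"
| "meta_transfer h (Suc k) = (let (a, b) = meta_transfer h k in
     (a * ((1 + monom 1 1) * path_rec (h - 3)) + b * path_rec (h - 4),
      a * (monom 1 1 * path_rec (h - 4)) + b * (monom 1 1 * path_rec (h - 5))))"

text \<open>
  Each cycle is entered at label \<open>0\<close> and left at label \<open>2\<close>; for the first and the last cycle one of
  these two labels is not constrained by the chain.
\<close>

locale meta_decomposition =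
  fixes E :: "'a rel" and h n :: nat and c :: "nat \<Rightarrow> int \<Rightarrow> 'a"
  assumes h_ge: "h \<ge> 4"
    and sym_E: "sym E"
    and cyc: "k < n \<Longrightarrow> cyclic_labelling E h (c k)"
    and arcs: "(x, y) \<in> E \<Longrightarrow> \<exists>k<n. x \<in> range (c k) \<and> y \<in> range (c k)"
    and link: "Suc k < n \<Longrightarrow> range (c k) \<inter> range (c (Suc k)) = {c (Suc k) 0}"
    and meta: "Suc k < n \<Longrightarrow> c k 2 = c (Suc k) 0"
    and far: "i < j \<Longrightarrow> j < n \<Longrightarrow> j \<noteq> Suc i \<Longrightarrow> range (c i) \<inter> range (c j) = {}"
begin

definition W :: "nat \<Rightarrow> 'a set" where
  "W k = (\<Union>i\<le>k. range (c i))"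

lemma irrefl:
  assumes "k < n" shows "(c k i, c k i) \<notin> E"
  using cyc[OF assms] h_ge dvd_small_int[of h "-1"] by (auto simp: cyclic_labelling_def)

lemma eq_iff:
  assumes "k < n" "\<bar>i - j\<bar> < int h"
  shows "c k i = c k j \<longleftrightarrow> i = j"
  using cyc[OF assms(1)] assms(2) dvd_small_int[of h "i - j"] by (auto simp: cyclic_labelling_def)

lemma adj_iff:
  assumes "k < n" "i \<in> {0..<int h}" "j \<in> {0..<int h}"
  shows "(c k i, c k j) \<in> E \<longleftrightarrow>
    j = i + 1 \<or> i = j + 1 \<or> i = 0 \<and> j = int h - 1 \<or> j = 0 \<and> i = int h - 1"
proof -
  \<comment> \<open>Within one period \<open>y - x - 1\<close> reaches absolute value
    \<open>h\<close> only for \<open>y = 0\<close>, \<open>x = h - 1\<close>, which is the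
    wrap-around edge.\<close>
  have "int h dvd y - x - 1 \<longleftrightarrow> y = x + 1 \<or> y = 0 \<and> x = int h - 1"
    if "x \<in> {0..<int h}" "y \<in> {0..<int h}" for x y
  proof (cases "y = 0 \<and> x = int h - 1")
    case False
    then have "\<bar>y - x - 1\<bar> < int h" using that by auto
    then have "int h dvd y - x - 1 \<longleftrightarrow> y - x - 1 = 0" using dvd_small_int[of h] by (metis dvd_0_right)
    then show ?thesis using False by auto
  qed auto
  then show ?thesis
    using cyc[OF assms(1)] assms(2,3) by (auto simp: cyclic_labelling_def)
qed

lemma finite_range: "k < n \<Longrightarrow> finite (range (c k))"
  using cyc_range[OF cyc, of k 0] h_ge by simp

lemma finite_W: "k < n \<Longrightarrow> finite (W k)"
  by (auto simp: W_def intro!: finite_range)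

lemma indep_poly_on_arc:
  assumes "k < n" "m < h"
  shows "indep_poly_on E (c k ` {a..<a + int m}) = path_rec m"
  using indep_poly_on_path[OF sym_E cyc_path_labelling[OF cyc[OF assms(1)] assms(2)]] h_ge by simp

text \<open>Among the cycles glued so far only \<open>c k\<close> meets the new one, since
  \<open>far\<close> separates it from all earlier ones.\<close>

lemma W_Int_next:
  assumes "Suc k < n"
  shows "W k \<inter> range (c (Suc k)) = {c (Suc k) 0}"
proof -
  have "range (c i) \<inter> range (c (Suc k)) \<subseteq> {c (Suc k) 0}" if "i \<le> k" for i
    using that assms link[of k] far[of i "Suc k"] by (cases "i = k") auto
  then have "W k \<inter> range (c (Suc k)) \<subseteq> {c (Suc k) 0}"
    unfolding W_def by blast
  moreover have "c (Suc k) 0 \<in> W k"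
    using link[OF assms] unfolding W_def by blast
  ultimately show ?thesis by blast
qed

text \<open>The arc would lie in a single cycle \<open>l\<close>. If \<open>l\<close> is at most
  \<open>Suc k\<close>, one endpoint lies in \<open>W k\<close> and in the new cycle and so is the
  gluing vertex; a later \<open>l\<close> would meet a cycle that is not its neighbour.\<close>

lemma no_cross:
  assumes k: "Suc k < n" and "x \<in> W k" "y \<in> range (c (Suc k))"
    and neq: "x \<noteq> c (Suc k) 0" "y \<noteq> c (Suc k) 0"
  shows "(x, y) \<notin> E"
proof
  assume "(x, y) \<in> E"
  then obtain l where l: "l < n" "x \<in> range (c l)" "y \<in> range (c l)" using arcs by blast
  obtain i where i: "i \<le> k" "x \<in> range (c i)" using assms(2) by (auto simp: W_def)
  consider "l \<le> k" | "l = Suc k" | "l > Suc k" by linarith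
  then show False
  proof cases
    case 1
    then have "y \<in> W k" using l by (auto simp: W_def)
    then show False using W_Int_next[OF k] assms(3) neq by auto
  next
    case 2
    then show False using W_Int_next[OF k] assms(2) l neq by auto
  next
    case 3
    then show False using far[of i l] i l by auto
  qed
qed

text \<open>Condition on the gluing vertex \<open>u\<close>: once it is decided, the old part and
  the new labels are independent of each other. Choosing \<open>u\<close> forbids the labels
  \<open>1\<close> and \<open>h - 1\<close>. The set \<open>I\<close> is left open because both
  states of the transfer step use it.\<close>

lemma indep_poly_on_glue:
  assumes k: "Suc k < n" and I: "I \<subseteq> {1..<int h}"
  defines "u \<equiv> c (Suc k) 0"
  shows "indep_poly_on E (W k \<union> c (Suc k) ` I) =
    indep_poly_on E (W k - {u}) * indep_poly_on E (c (Suc k) ` I) +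
    monom 1 1 * indep_poly_on E (W k - {u} - E `` {u}) * indep_poly_on E (c (Suc k) ` (I - {1, int h - 1}))"
proof -
  let ?d = "c (Suc k)"
  have finI: "finite I" using I finite_subset by blast
  have u: "u \<in> W k" using W_Int_next[OF k] by (auto simp: u_def)
  have d: "?d i \<noteq> u" if "i \<in> I" for i
    using eq_iff[OF k, of i 0] that I by (auto simp: u_def)
  have disj: "W k \<inter> ?d ` I = {}"
    using W_Int_next[OF k] d by (auto simp: u_def)
  have split: "indep_poly_on E (V \<union> ?d ` J) = indep_poly_on E V * indep_poly_on E (?d ` J)"
    if "V \<subseteq> W k - {u}" "J \<subseteq> I" for V J
  proof (rule indep_poly_on_union)
    show "finite V" using that finite_W[of k] k finite_subset by fastforce
    show "finite (?d ` J)" using that finI finite_subset by blast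
    show "V \<inter> ?d ` J = {}" using that disj by auto
    fix v w assume "v \<in> V" "w \<in> ?d ` J"
    then have "(v, w) \<notin> E" using that d by (intro no_cross[OF k]) (auto simp: u_def)
    then show "(v, w) \<notin> E \<and> (w, v) \<notin> E" using sym_E by (auto dest: symD)
  qed
  have "(u, ?d i) \<in> E \<longleftrightarrow> i \<in> {1, int h - 1}" if "i \<in> I" for i
    using adj_iff[OF k, of 0 i] that I h_ge by (auto simp: u_def)
  then have eq: "W k \<union> ?d ` I - {u} = (W k - {u}) \<union> ?d ` I"
    "(W k - {u}) \<union> ?d ` I - E `` {u} = (W k - {u} - E `` {u}) \<union> ?d ` (I - {1, int h - 1})"
    using d by auto
  have "indep_poly_on E (W k \<union> ?d ` I) = indep_poly_on E (W k \<union> ?d ` I - {u}) +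
      monom 1 1 * indep_poly_on E (W k \<union> ?d ` I - {u} - E `` {u})"
    by (rule indep_poly_on_delete) (use finite_W[of k] k finI u sym_E irrefl[OF k] in \<open>auto simp: u_def\<close>)
  then show ?thesis
    unfolding eq by (subst (asm) (1 2) split) (auto simp: mult.assoc)
qed

text \<open>The two components count independent sets avoiding and containing \<open>c k 2\<close>.
  By \<open>meta\<close> this vertex is where the next cycle is glued, so the state after
  \<open>k\<close> is exactly what \<open>indep_poly_on_glue\<close> consumes.\<close>

lemma indep_poly_on_W_states:
  assumes "k < n"
  shows "(indep_poly_on E (W k - {c k 2}), monom 1 1 * indep_poly_on E (W k - {c k 2} - E `` {c k 2})) = meta_transfer h k"
  using assms
proof (induction k)
  case 0
  let ?d = "c 0"
  \<comment> \<open>The window starts at \<open>2\<close> so that removing the marked label leaves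
    an interval.\<close>
  have W: "W 0 = ?d ` {2..<2 + int h}"
    using cyc_range[OF cyc[OF 0], of 2] h_ge by (simp add: W_def)
  have "?d i \<noteq> ?d 2" if "i \<in> {3..<3 + int (h - 1)}" for i
    using eq_iff[OF 0, of i 2] that h_ge by auto
  moreover have "{2..<2 + int h} = insert 2 {3..<3 + int (h - 1)}" using h_ge by auto
  ultimately have eq1: "W 0 - {?d 2} = ?d ` {3..<3 + int (h - 1)}"
    unfolding W by auto
  \<comment> \<open>In this window the neighbour \<open>1\<close> appears as \<open>h + 1\<close>;
    adding \<open>h\<close> to the difference brings it into the range where divisibility means
    zero.\<close>
  have "(?d 2, ?d i) \<in> E \<longleftrightarrow> i = 3 \<or> i = int h + 1" if "i \<in> {3..<3 + int (h - 1)}" for i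
  proof -
    have "\<bar>i - 2 - 1\<bar> < int h" "\<bar>2 - i - 1 + int h\<bar> < int h" using that h_ge by auto
    then have "int h dvd i - 2 - 1 \<longleftrightarrow> i - 2 - 1 = 0"
       "int h dvd 2 - i - 1 + int h \<longleftrightarrow> 2 - i - 1 + int h = 0"
      using dvd_small_int[of h] by (metis dvd_0_right)+
    then show ?thesis using cyc[OF 0] by (auto simp: cyclic_labelling_def)
  qed
  moreover have "{3..<3 + int (h - 1)} = {4..<4 + int (h - 3)} \<union> {3, int h + 1}" using h_ge by auto
  ultimately have eq2: "W 0 - {?d 2} - E `` {?d 2} = ?d ` {4..<4 + int (h - 3)}"
    unfolding eq1 by auto
  have "indep_poly_on E (W 0 - {?d 2}) = path_rec (h - 1)"
    unfolding eq1 by (rule indep_poly_on_arc[OF 0]) (use h_ge in simp)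
  moreover have "indep_poly_on E (W 0 - {?d 2} - E `` {?d 2}) = path_rec (h - 3)"
    unfolding eq2 by (rule indep_poly_on_arc[OF 0]) (use h_ge in simp)
  ultimately show ?case by simp
next
  case (Suc k)
  let ?d = "c (Suc k)" and ?u = "c (Suc k) 0"
  note k = \<open>Suc k < n\<close>
  define A where "A = indep_poly_on E (W k - {?u})"
  define B where "B = indep_poly_on E (W k - {?u} - E `` {?u})"
  have IH: "meta_transfer h k = (A, monom 1 1 * B)"
    using Suc meta[OF k] by (simp add: A_def B_def)
  have glue: "indep_poly_on E (W k \<union> ?d ` I) =
      A * indep_poly_on E (?d ` I) + monom 1 1 * B * indep_poly_on E (?d ` (I - {1, int h - 1}))"
    if "I \<subseteq> {1..<int h}" for I
    using indep_poly_on_glue[OF k that] by (simp add: A_def B_def)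
  have u: "?u \<in> W k" using W_Int_next[OF k] by auto
  have "range ?d = ?d ` {0..<0 + int h}" by (rule cyc_range[OF cyc[OF k]]) (use h_ge in simp)
  also have "{0..<0 + int h} = insert 0 {1..<int h}" using h_ge by auto
  finally have W: "W (Suc k) = W k \<union> ?d ` {1..<int h}"
    using u by (auto simp: W_def atMost_Suc)
  have notin: "?d i \<notin> W k" if "i \<in> {1..<int h}" for i
    using W_Int_next[OF k] eq_iff[OF k, of i 0] that by auto
  have inj: "?d i = ?d j \<longleftrightarrow> i = j" if "i \<in> {0..<int h}" "j \<in> {0..<int h}" for i j
    using eq_iff[OF k, of i j] that by auto
  have "inj_on ?d {1..<int h}" using inj by (auto simp: inj_on_def)
  then have "?d ` ({1..<int h} - {2}) = ?d ` {1..<int h} - ?d ` {2}"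
    by (rule inj_on_image_set_diff) (use h_ge in auto)
  then have eq1: "W (Suc k) - {?d 2} = W k \<union> ?d ` ({1..<int h} - {2})"
    using notin[of 2] h_ge unfolding W by auto
  \<comment> \<open>Since \<open>h\<close> is at least \<open>4\<close>, label \<open>2\<close> is
    not adjacent to the entry label \<open>0\<close>, so the marked vertex has no neighbours in the
    old part.\<close>
  have nbW: "(?d 2, x) \<notin> E" if "x \<in> W k" for x
  proof (cases "x = ?u")
    case True
    then show ?thesis using adj_iff[OF k, of 2 0] h_ge by auto
  next
    case False
    then have "(x, ?d 2) \<notin> E" using that inj[of 2 0] h_ge by (intro no_cross[OF k]) auto
    then show ?thesis using sym_E by (auto dest: symD)
  qed
  have "(?d 2, ?d i) \<in> E \<longleftrightarrow> i = 1 \<or> i = 3" if "i \<in> {1..<int h} - {2}" for i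
    using adj_iff[OF k, of 2 i] that h_ge by auto
  moreover have "{1..<int h} - {2} = {1, 3} \<union> {4..<int h}" using h_ge by auto
  ultimately have eq2: "W (Suc k) - {?d 2} - E `` {?d 2} = W k \<union> ?d ` {4..<int h}"
    unfolding eq1 using nbW by auto
  \<comment> \<open>Without labels \<open>0\<close> and \<open>2\<close> the new cycle falls apart
    into the single vertex \<open>1\<close> and a path on \<open>h - 3\<close> vertices.\<close>
  have "{1..<int h} - {2} = {1..<1 + int 1} \<union> {3..<3 + int (h - 3)}" using h_ge by auto
  then have s1: "?d ` ({1..<int h} - {2}) = ?d ` {1..<1 + int 1} \<union> ?d ` {3..<3 + int (h - 3)}"
    by (simp only: image_Un)
  have "indep_poly_on E (?d ` ({1..<int h} - {2})) =
      indep_poly_on E (?d ` {1..<1 + int 1}) * indep_poly_on E (?d ` {3..<3 + int (h - 3)})"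
    unfolding s1
  proof (rule indep_poly_on_union)
    show "?d ` {1..<1 + int 1} \<inter> ?d ` {3..<3 + int (h - 3)} = {}"
      using inj h_ge by auto
    fix v w assume "v \<in> ?d ` {1..<1 + int 1}" "w \<in> ?d ` {3..<3 + int (h - 3)}"
    moreover have "{1..<1 + int 1} = {1}" by auto
    ultimately obtain i where "v = ?d 1" "w = ?d i" "i \<in> {3..<int h}" using h_ge by auto
    then show "(v, w) \<notin> E \<and> (w, v) \<notin> E"
      using adj_iff[OF k, of 1 i] adj_iff[OF k, of i 1] h_ge by auto
  qed simp_all
  also have "\<dots> = (1 + monom 1 1) * path_rec (h - 3)"
    using h_ge by (simp only: indep_poly_on_arc[OF k]) simp
  finally have p1: "indep_poly_on E (?d ` ({1..<int h} - {2})) = (1 + monom 1 1) * path_rec (h - 3)" .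
  have "{1..<int h} - {2} - {1, int h - 1} = {3..<3 + int (h - 4)}" using h_ge by auto
  then have p2: "indep_poly_on E (?d ` ({1..<int h} - {2} - {1, int h - 1})) = path_rec (h - 4)"
    using indep_poly_on_arc[OF k, of "h - 4" 3] h_ge by simp
  have "{4..<int h} = {4..<4 + int (h - 4)}" using h_ge by auto
  then have p3: "indep_poly_on E (?d ` {4..<int h}) = path_rec (h - 4)"
    using indep_poly_on_arc[OF k, of "h - 4" 4] h_ge by simp
  \<comment> \<open>For \<open>h = 4\<close> and \<open>h = 5\<close> both sides are empty, in
    agreement with the truncated \<open>h - 5\<close>.\<close>
  have "{4..<int h} - {1, int h - 1} = {4..<4 + int (h - 5)}" using h_ge by auto
  then have p4: "indep_poly_on E (?d ` ({4..<int h} - {1, int h - 1})) = path_rec (h - 5)"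
    using indep_poly_on_arc[OF k, of "h - 5" 4] h_ge by simp
  have "indep_poly_on E (W (Suc k) - {?d 2}) = A * ((1 + monom 1 1) * path_rec (h - 3)) + monom 1 1 * B * path_rec (h - 4)"
    unfolding eq1 using glue[of "{1..<int h} - {2}"] by (simp only: p1 p2) auto
  moreover have "indep_poly_on E (W (Suc k) - {?d 2} - E `` {?d 2}) = A * path_rec (h - 4) + monom 1 1 * B * path_rec (h - 5)"
    unfolding eq2 using glue[of "{4..<int h}"] by (simp only: p3 p4) auto
  ultimately show ?case by (simp add: IH algebra_simps)
qed

lemma indep_poly_on_W:
  assumes "k < n"
  shows "indep_poly_on E (W k) = fst (meta_transfer h k) + snd (meta_transfer h k)"
proof -
  have "c k 2 \<in> W k" by (auto simp: W_def)
  then have "indep_poly_on E (W k) = indep_poly_on E (W k - {c k 2}) + monom 1 1 * indep_poly_on E (W k - {c k 2} - E `` {c k 2})"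
    using finite_W sym_E irrefl assms by (intro indep_poly_on_delete) auto
  then show ?thesis by (simp flip: indep_poly_on_W_states[OF assms])
qed

end

section \<open>The linear recurrence of the transfer matrix\<close>

text \<open>The trace \<open>(1 + x) * path_rec (h - 3) + x * path_rec (h - 5)\<close> becomes
  \<alpha> once \<open>q3\<close> eliminates index \<open>h - 3\<close>. In the determinant,
  \<open>q4\<close> cancels the terms linear in \<open>x\<close> and leaves \<open>x^2\<close> times
  \<beta>.\<close>

lemma meta_transfer_recurrence:
  assumes "h \<ge> 4"
  defines "x \<equiv> monom 1 1 :: int poly" and "p \<equiv> path_poly" and "k \<equiv> int h"
    and "f \<equiv> (\<lambda>m. fst (meta_transfer h m) + snd (meta_transfer h m))"
  shows "f (Suc (Suc m)) =
    (x^2 * p (k - 5) + x * (p (k - 4) + 2 * p (k - 5)) + p (k - 4)) * f (Suc m) -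
    x^2 * (x * (p (k - 5))^2 + (p (k - 5))^2 + p (k - 4) * p (k - 5) - p (k - 4) * p (k - 6)) * f m"
proof -
  have P: "p (int i) = path_rec i" for i by (simp add: p_def path_poly_of_nat)
  have p4: "p (k - 4) = path_rec (h - 4)" using P[of "h - 4"] assms(1) by (simp add: k_def of_nat_diff)
  have p5: "p (k - 5) = path_rec (h - 5)"
  proof (cases "h = 4")
    case False
    then show ?thesis using P[of "h - 5"] assms(1) by (simp add: k_def of_nat_diff)
  qed (simp add: k_def p_def path_poly_small)
  \<comment> \<open>The path recursion persists at the small indices because
    \<open>path_poly (-2) = 0\<close> (for \<open>h = 4\<close>) and
    \<open>path_poly (-1) = 1\<close> (for \<open>h = 5\<close>).\<close>
  have q4: "path_rec (h - 4) = path_rec (h - 5) + x * p (k - 6)"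
  proof -
    consider "h = 4" | "h = 5" | "h \<ge> 6" using assms(1) by linarith
    then show ?thesis
    proof cases
      case 3
      then have "p (k - 6) = path_rec (h - 6)" "h - 5 = Suc (h - 6)" "h - 4 = Suc (Suc (h - 6))"
        using P[of "h - 6"] by (simp_all add: k_def of_nat_diff)
      then show ?thesis by (simp add: x_def)
    qed (simp_all add: k_def p_def path_poly_small x_def)
  qed
  have q3: "path_rec (h - 3) = path_rec (h - 4) + x * path_rec (h - 5)"
  proof (cases "h = 4")
    case False
    then have "h - 4 = Suc (h - 5)" "h - 3 = Suc (Suc (h - 5))" using assms(1) by auto
    then show ?thesis by (simp add: x_def)
  qed (simp add: x_def)
  obtain a b where ab: "meta_transfer h m = (a, b)" by fastforce
  show ?thesis
    unfolding p4 p5 f_def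
    by (simp only: meta_transfer.simps ab q3 Let_def prod.case fst_conv snd_conv flip: x_def)
      (simp add: q4 algebra_simps power2_eq_square)
qed

subsection \<open>Nonseparable graphs and blocks\<close>

text \<open>Walks must stay inside \<open>S\<close>, so deleting a vertex is just passing to a
  smaller set. The empty set counts as connected.\<close>

definition connected_on :: "'a rel \<Rightarrow> 'a set \<Rightarrow> bool" where
  "connected_on E S \<longleftrightarrow> (\<forall>x\<in>S. \<forall>y\<in>S. (x, y) \<in> (E \<inter> S \<times> S)\<^sup>*)"

lemma connected_on_Un:
  assumes "connected_on E S" "connected_on E T" "S \<inter> T \<noteq> {}"
  shows "connected_on E (S \<union> T)"
proof -
  let ?R = "\<lambda>S. (E \<inter> S \<times> S)\<^sup>*"
  obtain z where z: "z \<in> S" "z \<in> T" using assms(3) by blast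
  have sub: "?R S \<subseteq> ?R (S \<union> T)" "?R T \<subseteq> ?R (S \<union> T)" by (rule rtrancl_mono; blast)+
  have "(x, z) \<in> ?R (S \<union> T) \<and> (z, x) \<in> ?R (S \<union> T)" if "x \<in> S \<union> T" for x
    using assms(1,2) z that sub unfolding connected_on_def by blast
  then show ?thesis unfolding connected_on_def by (meson rtrancl_trans)
qed

lemma connected_on_mono: "E \<subseteq> F \<Longrightarrow> connected_on E S \<Longrightarrow> connected_on F S"
  unfolding connected_on_def by (meson Int_mono order_refl rtrancl_mono subsetD)

lemma connected_on_arc:
  assumes "sym E" "\<And>i. (c i, c (i + 1)) \<in> E"
  shows "connected_on E (c ` {a..<a + int m})"
proof (induction m)
  case (Suc m)
  show ?case
  proof (cases "m = 0")
    case True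
    then have "{a..<a + int (Suc m)} = {a}" by auto
    then show ?thesis by (simp add: connected_on_def)
  next
    case False
    let ?i = "a + int m - 1"
    have "(c ?i, c (?i + 1)) \<in> E" "(c (?i + 1), c ?i) \<in> E"
      using assms(2)[of ?i] assms(1) by (auto dest: symD)
    then have "connected_on E {c ?i, c (?i + 1)}" by (auto simp: connected_on_def)
    from connected_on_Un[OF Suc this] have "connected_on E (c ` {a..<a + int m} \<union> {c ?i, c (?i + 1)})"
      using False by auto
    moreover have "c ` {a..<a + int m} \<union> {c ?i, c (?i + 1)} = c ` ({a..<a + int m} \<union> {?i, ?i + 1})"
      by auto
    moreover have "{a..<a + int m} \<union> {?i, ?i + 1} = {a..<a + int (Suc m)}"
      using False by auto
    ultimately show ?thesis by metis
  qed
qed (simp add: connected_on_def)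

text \<open>Each new set meets the union so far through its predecessor.\<close>

lemma connected_on_chain:
  assumes "a \<le> b" "\<And>i. a \<le> i \<Longrightarrow> i \<le> b \<Longrightarrow> connected_on E (S i)"
    and "\<And>i. a \<le> i \<Longrightarrow> i < b \<Longrightarrow> S i \<inter> S (Suc i) \<noteq> {}"
  shows "connected_on E (\<Union>i\<in>{a..b}. S i)"
  using assms
proof (induction b rule: dec_induct)
  case (step b)
  have "connected_on E ((\<Union>i\<in>{a..b}. S i) \<union> S (Suc b))"
  proof (rule connected_on_Un)
    show "(\<Union>i\<in>{a..b}. S i) \<inter> S (Suc b) \<noteq> {}"
      using step.prems(2)[of b] step.hyps by fastforce
  qed (use step in auto)
  moreover have "(\<Union>i\<in>{a..Suc b}. S i) = (\<Union>i\<in>{a..b}. S i) \<union> S (Suc b)"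
    using step.hyps by (auto simp: atLeastAtMostSuc_conv)
  ultimately show ?case by simp
qed auto

section \<open>Connectivity and relabelling of cycles\<close>

lemma cyc_succ: "cyclic_labelling E h c \<Longrightarrow> (c i, c (i + 1)) \<in> E"
  by (simp add: cyclic_labelling_def)

lemma cyc_connected_on:
  assumes "cyclic_labelling E h c" "sym E" "h > 0"
  shows "connected_on E (range c)"
proof -
  have "connected_on E (c ` {0..<0 + int h})"
    by (rule connected_on_arc) (use assms cyc_succ in auto)
  then show ?thesis using cyc_range[OF assms(1,3), of 0] by simp
qed

text \<open>Opening the cycle at label \<open>k\<close> leaves the arc of labels
  \<open>k + 1\<close> to \<open>k + h - 1\<close>.\<close>

lemma cyc_connected_on_delete:
  assumes "cyclic_labelling E h c" "sym E" "h > 0"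
  shows "connected_on E (range c - {v})"
proof -
  have arc: "connected_on E (c ` {a..<a + int m})" for a m
    by (rule connected_on_arc) (use assms cyc_succ in auto)
  show ?thesis
  proof (cases "v \<in> range c")
    case True
    then obtain k where v: "v = c k" by blast
    have "range c = c ` {k..<k + int h}" by (rule cyc_range[OF assms(1,3)])
    also have "{k..<k + int h} = insert k {k + 1..<k + 1 + int (h - 1)}" using assms(3) by auto
    finally have "range c = insert (c k) (c ` {k + 1..<k + 1 + int (h - 1)})" by simp
    moreover have "c i \<noteq> c k" if "i \<in> {k + 1..<k + 1 + int (h - 1)}" for i
    proof -
      have "i - k \<noteq> 0" "\<bar>i - k\<bar> < int h" using that assms(3) by auto
      then show ?thesis using assms(1) dvd_small_int[of h "i - k"] by (auto simp: cyclic_labelling_def)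
    qed
    ultimately have "range c - {v} = c ` {k + 1..<k + 1 + int (h - 1)}"
      unfolding v by auto
    then show ?thesis using arc by simp
  next
    case False
    then show ?thesis
      using arc[of 0 h] cyc_range[OF assms(1,3), of 0] by simp
  qed
qed

text \<open>If \<open>m\<close> has label \<open>k\<close>, then \<open>u\<close> and
  \<open>v\<close> carry the labels \<open>k - 1\<close> and \<open>k + 1\<close> in some order; a
  translation settles one order and a reflection the other.\<close>

lemma cyc_label_distance_two:
  assumes c: "cyclic_labelling E h c" and uv: "u \<noteq> v" "u \<in> range c" "v \<in> range c" "m \<in> range c"
    and "(u, m) \<in> E" "(m, v) \<in> E"
  shows "\<exists>d. cyclic_labelling E h d \<and> range d = range c \<and> d 0 = u \<and> d 2 = v"
proof -
  obtain i j k where ijk: "u = c i" "v = c j" "m = c k" using uv by blast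
  have eq: "c x = c y \<longleftrightarrow> int h dvd x - y" for x y using c by (simp add: cyclic_labelling_def)
  have "c i = c (k - 1) \<or> c i = c (k + 1)"
  proof -
    have "int h dvd k - i - 1 \<or> int h dvd i - k - 1" using c assms(6) ijk by (simp add: cyclic_labelling_def)
    then show ?thesis unfolding eq using dvd_diff_commute[of "int h" "k - 1" i] by (auto simp: algebra_simps)
  qed
  moreover have "c j = c (k - 1) \<or> c j = c (k + 1)"
  proof -
    have "int h dvd j - k - 1 \<or> int h dvd k - j - 1" using c assms(7) ijk by (simp add: cyclic_labelling_def)
    then show ?thesis unfolding eq using dvd_diff_commute[of "int h" "k - 1" j] by (auto simp: algebra_simps)
  qed
  ultimately consider "u = c (k - 1)" "v = c (k + 1)" | "u = c (k + 1)" "v = c (k - 1)"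
    using uv(1) ijk by auto
  then show ?thesis
  proof cases
    case 1
    let ?d = "\<lambda>i. c (i + (k - 1))"
    have "range ?d = range c"
      using surj_plus_right[of "k - 1"] by (metis image_image)
    then show ?thesis using cyc_shift[OF c, of "k - 1"] 1
      by (intro exI[of _ ?d]) (simp add: add.commute)
  next
    case 2
    \<comment> \<open>This is the label \<open>k + 1 - i\<close>, which reverses the cycle and sends
      \<open>0\<close> to \<open>k + 1\<close> and \<open>2\<close> to \<open>k - 1\<close>.\<close>
    let ?d = "\<lambda>i. c (- (i + - (k + 1)))"
    have "x \<in> range ?d" if x: "x \<in> range c" for x
    proof -
      obtain y where "x = c y" using x by blast
      then have "x = ?d (k + 1 - y)" by simp
      then show ?thesis by blast
    qed
    then have "range ?d = range c" by auto
    moreover have "cyclic_labelling E h ?d"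
      using cyc_shift[OF cyc_reflect[OF c], of "- (k + 1)"] .
    ultimately show ?thesis using 2 by (intro exI[of _ ?d]) (simp add: algebra_simps)
  qed
qed

lemma cyc_rotate:
  assumes "cyclic_labelling E h c" "v \<in> range c"
  shows "\<exists>d. cyclic_labelling E h d \<and> range d = range c \<and> d a = v"
proof -
  obtain k where k: "v = c k" using assms by blast
  let ?d = "\<lambda>i. c (i + (k - a))"
  have "x \<in> range ?d" if x: "x \<in> range c" for x
  proof -
    obtain y where "x = c y" using x by blast
    then have "x = ?d (y - (k - a))" by simp
    then show ?thesis by blast
  qed
  then have "range ?d = range c" by auto
  then show ?thesis using cyc_shift[OF assms(1), of "k - a"] k by (intro exI[of _ ?d]) simp
qed

section \<open>Nonseparable subgraphs and their extension to blocks\<close>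

lemma pair_graphI:
  assumes "finite (pverts G)" "parcs G \<subseteq> pverts G \<times> pverts G" "sym (parcs G)"
    and "\<And>x. (x, x) \<notin> parcs G"
  shows "pair_graph G"
proof -
  have "finite (parcs G)" using assms(1,2) finite_subset by blast
  then show ?thesis
    by unfold_locales (use assms in \<open>auto simp: symmetric_def\<close>)
qed

lemma subgraph_pair_iff:
  "subgraph (with_proj H) (with_proj G) \<longleftrightarrow>
    pverts H \<subseteq> pverts G \<and> parcs H \<subseteq> parcs G \<and> pair_wf_digraph G \<and> pair_wf_digraph H"
  by (auto simp: subgraph_def wf_digraph_wp_iff)

text \<open>Bridges ordinary reflexive transitive closure, used by \<open>connected_on\<close>, to
  \<open>rtrancl_on\<close>, on which digraph reachability is based.\<close>

lemma rtrancl_on_if_rtrancl: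
  assumes "(x, y) \<in> R\<^sup>*" "x \<in> F" "R \<subseteq> r \<inter> F \<times> F"
  shows "(x, y) \<in> rtrancl_on F r"
  using assms(1)
proof (induction rule: rtrancl_induct)
  case (step y z)
  then show ?case using assms(3) by (blast intro: rtrancl_on_into_rtrancl_on)
qed (use assms(2) in auto)

lemma nonseparableI:
  assumes G: "pair_graph G" and ne: "pverts G \<noteq> {}"
    and del: "\<And>v. connected_on (parcs G) (pverts G - {v})" and con: "connected_on (parcs G) (pverts G)"
  shows "nonseparable G"
proof -
  \<comment> \<open>\<open>connected\<close> means strong connectivity of the symmetric closure,
    hence \<open>mk_symmetric\<close>.\<close>
  have "u \<rightarrow>\<^sup>*\<^bsub>with_proj (mk_symmetric (with_proj G))\<^esub> v"
    if "u \<in> pverts G" "v \<in> pverts G" for u v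
    unfolding reachable_def
    by (rule rtrancl_on_if_rtrancl[of _ _ "parcs G \<inter> pverts G \<times> pverts G"])
      (use con that in \<open>force simp: connected_on_def parcs_mk_symmetric\<close>)+
  then have "connected (with_proj G)"
    unfolding connected_def using ne by (intro strongly_connectedI) simp_all
  moreover have "x \<rightarrow>\<^sup>*\<^bsub>pre_digraph.del_vert (with_proj G) v\<^esub> y"
    if "x \<in> pverts G - {v}" "y \<in> pverts G - {v}" for x y v
    unfolding reachable_def
    by (rule rtrancl_on_if_rtrancl[of _ _ "parcs G \<inter> (pverts G - {v}) \<times> (pverts G - {v})"])
      (use del[of v] that in \<open>force simp: connected_on_def arcs_ends_conv pre_digraph.del_vert_simps\<close>)+
  ultimately show ?thesis
    using G unfolding nonseparable_def cut_vertex_def by blast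
qed

text \<open>By finiteness there is a nonseparable subgraph above \<open>B\<close> with the most
  vertices and arcs in total; it is maximal under inclusion.\<close>

lemma block_exists:
  assumes G: "pair_graph G" and B: "nonseparable B" "subgraph (with_proj B) (with_proj G)"
  shows "\<exists>B'. block G B' \<and> subgraph (with_proj B) (with_proj B')"
proof -
  interpret G: pair_graph G by (rule G)
  let ?P = "\<lambda>B'. nonseparable B' \<and> subgraph (with_proj B') (with_proj G) \<and> subgraph (with_proj B) (with_proj B')"
  \<comment> \<open>Both kinds are counted so that, for nested subgraphs, equal size forces equality
    of the graphs.\<close>
  let ?f = "\<lambda>B'. card (pverts B') + card (parcs B')"
  have le: "?f B' \<le> ?f B''" "?f B'' \<le> ?f B' \<Longrightarrow> B'' = B'"
    if "subgraph (with_proj B') (with_proj B'')" "subgraph (with_proj B'') (with_proj G)" for B' B''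
  proof -
    have sub: "pverts B' \<subseteq> pverts B''" "parcs B' \<subseteq> parcs B''"
      and fin: "finite (pverts B'')" "finite (parcs B'')"
      using that G.pair_finite_verts G.pair_finite_arcs
      by (auto simp: subgraph_pair_iff intro: finite_subset)
    then have le: "card (pverts B') \<le> card (pverts B'')" "card (parcs B') \<le> card (parcs B'')"
      by (auto intro: card_mono)
    then show "?f B' \<le> ?f B''" by simp
    assume "?f B'' \<le> ?f B'"
    then have "pverts B' = pverts B''" "parcs B' = parcs B''"
      using card_seteq[OF fin(1) sub(1)] card_seteq[OF fin(2) sub(2)] le by linarith+
    then show "B'' = B'" by simp
  qed
  have "subgraph (with_proj B) (with_proj B)" using B(2) by (auto simp: subgraph_pair_iff)
  then have "?P B" using B by simp
  moreover have "\<forall>B'. ?P B' \<longrightarrow> ?f B' < Suc (?f G)"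
  proof (intro allI impI)
    fix B' assume "?P B'"
    then have "?f B' \<le> ?f G"
      by (intro le(1)) (auto simp: subgraph_pair_iff)
    then show "?f B' < Suc (?f G)" by simp
  qed
  ultimately obtain B' where B': "?P B'" "\<And>B''. ?P B'' \<Longrightarrow> ?f B'' \<le> ?f B'"
    using ex_has_greatest_nat[of ?P B ?f] by blast
  have "block G B'"
    unfolding block_def
  proof (intro conjI allI impI)
    fix B'' assume B'': "nonseparable B'' \<and> subgraph (with_proj B'') (with_proj G) \<and> subgraph (with_proj B') (with_proj B'')"
    then have "?P B''" using B' by (blast intro: subgraph_trans)
    then show "B'' = B'" using le(2) B'' B'(2) by blast
  qed (use B' in auto)
  then show ?thesis using B' by blast
qed

section \<open>Periodic labelling of a cycle\<close>

lemma pcas_verts: "pcas u p v \<Longrightarrow> pawalk_verts u p = u # map snd p"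
  by (induction u p v rule: pcas.induct) auto

lemma pcas_nth_Suc: "pcas u p v \<Longrightarrow> Suc i < length p \<Longrightarrow> fst (p ! Suc i) = snd (p ! i)"
proof (induction u p v arbitrary: i rule: pcas.induct)
  case (2 u e es v)
  then show ?case by (cases i; cases es) auto
qed simp

lemma pcas_ends: "pcas u p v \<Longrightarrow> p \<noteq> [] \<Longrightarrow> fst (hd p) = u \<and> snd (last p) = v"
proof (induction u p v rule: pcas.induct)
  case (2 u e es v)
  then show ?case by (cases es) auto
qed simp

text \<open>Label \<open>i\<close> is the head of the arc at position \<open>i\<close> modulo the
  length of the closed walk. Distinct heads make labels agree exactly modulo that length, and length
  at least \<open>3\<close> gives the size bound.\<close>

lemma cycle_graph_cyc:
  assumes "cycle_graph C"
  shows "\<exists>c. cyclic_labelling (parcs C) (card (pverts C)) c \<and> range c = pverts C"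
    and "card (pverts C) \<ge> 3" and "parcs C \<subseteq> pverts C \<times> pverts C" and "sym (parcs C)"
proof -
  obtain p where p: "pre_digraph.cycle (with_proj C) p" "length p \<ge> 3"
    "pverts C = fst ` set p" "parcs C = set p \<union> (set p)\<inverse>"
    using assms unfolding cycle_graph_def by blast
  obtain u where u: "pcas u p u" "distinct (tl (pawalk_verts u p))"
    using p(1) unfolding pre_digraph.cycle_def pre_digraph.awalk_def
      cas_with_proj_eq awalk_verts_with_proj_eq by blast
  let ?n = "length p"
  have n: "?n > 0" using p(2) by linarith
  have dist: "distinct (map snd p)" using u pcas_verts[OF u(1)] by simp
  define c where "c i = snd (p ! nat (i mod int ?n))" for i
  have idx: "nat (i mod int ?n) < ?n" for i using n by (simp add: nat_less_iff)
  have c_eq: "c i = c j \<longleftrightarrow> int ?n dvd i - j" for i j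
  proof -
    have "c i = map snd p ! nat (i mod int ?n)" for i using idx by (simp add: c_def)
    then have "c i = c j \<longleftrightarrow> nat (i mod int ?n) = nat (j mod int ?n)"
      using nth_eq_iff_index_eq[OF dist] idx by (simp only: length_map)
    also have "\<dots> \<longleftrightarrow> i mod int ?n = j mod int ?n" using n by (simp add: nat_eq_iff)
    finally show ?thesis by (simp add: mod_eq_dvd_iff)
  qed
  \<comment> \<open>Consecutive arcs match head to tail; at position \<open>0\<close> the preceding
    arc is the last one, because the walk is closed.\<close>
  have arc: "p ! nat (i mod int ?n) = (c (i - 1), c i)" for i
  proof -
    let ?k = "nat (i mod int ?n)"
    have "fst (p ! ?k) = c (i - 1)"
    proof (cases ?k)
      case 0
      then have "i mod int ?n = 0" using n by (simp add: nat_eq_iff)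
      then have "int ?n dvd (i - 1) - (int ?n - 1)" by (simp add: mod_eq_0_iff_dvd dvd_diff)
      then have "(i - 1) mod int ?n = (int ?n - 1) mod int ?n" by (simp only: mod_eq_dvd_iff)
      also have "\<dots> = int ?n - 1" by (rule mod_pos_pos_trivial) (use n in linarith)+
      finally have "nat ((i - 1) mod int ?n) = ?n - 1" using n by linarith
      then have "c (i - 1) = snd (last p)" using n by (simp add: c_def last_conv_nth)
      then show ?thesis using pcas_ends[OF u(1)] n 0 by (auto simp: hd_conv_nth)
    next
      case (Suc m)
      then have m: "i mod int ?n = int m + 1" by linarith
      then have "int ?n dvd i - (int m + 1)" by (metis dvd_minus_mod)
      then have "int ?n dvd (i - 1) - int m" by (simp add: algebra_simps)
      then have "(i - 1) mod int ?n = int m mod int ?n" by (simp only: mod_eq_dvd_iff)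
      also have "\<dots> = int m" using idx[of i] Suc by (simp add: zmod_trivial_iff)
      finally have "c (i - 1) = snd (p ! m)" by (simp add: c_def)
      then show ?thesis using pcas_nth_Suc[OF u(1), of m] idx[of i] Suc by simp
    qed
    then show ?thesis by (simp add: c_def prod_eq_iff)
  qed
  have set_p: "set p = range (\<lambda>i. (c (i - 1), c i))"
  proof (intro equalityI subsetI)
    fix e assume "e \<in> set p"
    then obtain i where i: "i < ?n" "e = p ! i" by (auto simp: in_set_conv_nth)
    then have "e = p ! nat (int i mod int ?n)" by simp
    then show "e \<in> range (\<lambda>i. (c (i - 1), c i))" by (simp add: arc)
  next
    fix e assume "e \<in> range (\<lambda>i. (c (i - 1), c i))"
    then obtain i where "e = p ! nat (i mod int ?n)" by (auto simp: arc)
    then show "e \<in> set p" using idx[of i] by simp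
  qed
  have in_p: "(c i, c j) \<in> set p \<longleftrightarrow> int ?n dvd j - i - 1" for i j
  proof
    assume "(c i, c j) \<in> set p"
    then obtain k where k: "c i = c (k - 1)" "c j = c k" by (auto simp: set_p)
    have "int ?n dvd (j - k) - (i - (k - 1))" by (rule dvd_diff) (use k c_eq in blast)+
    also have "(j - k) - (i - (k - 1)) = j - i - 1" by simp
    finally show "int ?n dvd j - i - 1" .
  next
    assume "int ?n dvd j - i - 1"
    then have "int ?n dvd (j - 1) - i" by (simp add: algebra_simps)
    then have "c (j - 1) = c i" using c_eq by blast
    then show "(c i, c j) \<in> set p" by (auto simp: set_p intro: range_eqI[of _ _ j])
  qed
  have cyc: "cyclic_labelling (parcs C) ?n c"
    unfolding cyclic_labelling_def by (auto simp: c_eq in_p p(4))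
  have "c j \<in> range (\<lambda>i. c (i - 1))" for j by (rule range_eqI[of _ _ "j + 1"]) simp
  then have rng: "range c = pverts C" by (auto simp: p(3) set_p image_image)
  have "card (pverts C) = card (c ` {0..<int ?n})"
    using cyc_range[OF cyc, of 0] n rng by simp
  also have "\<dots> = ?n"
    using dvd_small_int[of ?n] by (subst card_image) (force simp: inj_on_def c_eq)+
  finally have card: "card (pverts C) = ?n" .
  show "\<exists>c. cyclic_labelling (parcs C) (card (pverts C)) c \<and> range c = pverts C"
    "card (pverts C) \<ge> 3"
    using cyc rng card p(2) by auto
  show "parcs C \<subseteq> pverts C \<times> pverts C"
    unfolding p(4) set_p using rng by auto
  show "sym (parcs C)" unfolding p(4) by (auto simp: sym_def)
qed

lemma cycle_graph_connected_on:
  assumes "cycle_graph C"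
  shows "connected_on (parcs C) (pverts C)" "connected_on (parcs C) (pverts C - {v})"
proof -
  obtain c where "cyclic_labelling (parcs C) (card (pverts C)) c" "range c = pverts C" "card (pverts C) > 0"
    using cycle_graph_cyc[OF assms] by auto
  then show "connected_on (parcs C) (pverts C)" "connected_on (parcs C) (pverts C - {v})"
    using cyc_connected_on cyc_connected_on_delete cycle_graph_cyc(4)[OF assms] by metis+
qed

subsection \<open>The cycles of a chain cactus\<close>

text \<open>\<open>v i\<close> fixes the junction whose existence \<open>chain_order\<close>
  asserts. Cycle size and meta-position enter later, as hypotheses of single lemmas.\<close>

locale chain_cactus_cycles =
  fixes G :: "'a pair_pre_digraph" and Cs :: "'a pair_pre_digraph list" and v :: "nat \<Rightarrow> 'a"
  assumes cactus: "chain_cactus G"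
    and Cs: "distinct Cs" "set Cs = cycles_of G"
    and v: "\<And>i. Suc i < length Cs \<Longrightarrow>
      cut_vertex G (v i) \<and> pverts (Cs ! i) \<inter> pverts (Cs ! Suc i) = {v i}"
begin

sublocale pair_graph G
  using cactus by (simp add: chain_cactus_def cactus_def)

lemma Cs_nth:
  assumes "i < length Cs"
  shows "cycle_graph (Cs ! i)" "subgraph (with_proj (Cs ! i)) (with_proj G)" "Cs ! i \<in> cycles_of G"
proof -
  show "Cs ! i \<in> cycles_of G" using nth_mem[OF assms] unfolding Cs(2) .
  then show "cycle_graph (Cs ! i)" "subgraph (with_proj (Cs ! i)) (with_proj G)"
    unfolding cycles_of_def by blast+
qed

lemma sub_Cs:
  assumes "i < length Cs"
  shows "pverts (Cs ! i) \<subseteq> pverts G" "parcs (Cs ! i) \<subseteq> parcs G"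
  using Cs_nth(2)[OF assms] by (auto simp: subgraph_pair_iff)

text \<open>A nonseparable subgraph extends to a block, and every block of a chain cactus is a
  cycle.\<close>

lemma in_some_cycle:
  assumes "nonseparable B" "subgraph (with_proj B) (with_proj G)"
  shows "\<exists>D\<in>cycles_of G. subgraph (with_proj B) (with_proj D)"
proof -
  obtain B' where B': "block G B'" "subgraph (with_proj B) (with_proj B')"
    using block_exists[OF _ assms] by blast
  then have "cycle_graph B'" "subgraph (with_proj B') (with_proj G)"
    using cactus by (auto simp: chain_cactus_def block_def)
  then show ?thesis using B' by (auto simp: cycles_of_def)
qed

text \<open>A single vertex forms a nonseparable graph, so it lies in some cycle.\<close>

lemma cover_verts:
  assumes "x \<in> pverts G"
  shows "\<exists>i<length Cs. x \<in> pverts (Cs ! i)"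
proof -
  let ?B = "\<lparr>pverts = {x}, parcs = {}\<rparr>"
  have B: "pair_graph ?B" by (rule pair_graphI) (auto simp: sym_def)
  then interpret B: pair_graph ?B .
  have "nonseparable ?B"
    by (rule nonseparableI[OF B]) (auto simp: connected_on_def)
  moreover have "subgraph (with_proj ?B) (with_proj G)"
    using assms B.pair_wf_digraph_axioms pair_wf_digraph_axioms by (simp add: subgraph_pair_iff)
  ultimately obtain D where "D \<in> cycles_of G" "subgraph (with_proj ?B) (with_proj D)"
    using in_some_cycle by blast
  moreover from this obtain i where "i < length Cs" "D = Cs ! i" using Cs(2) by (metis in_set_conv_nth)
  ultimately show ?thesis by (auto simp: subgraph_pair_iff)
qed

text \<open>A single edge is nonseparable, so bridges cannot occur.\<close>

lemma cover_arcs: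
  assumes "(x, y) \<in> parcs G"
  shows "\<exists>i<length Cs. (x, y) \<in> parcs (Cs ! i)"
proof -
  let ?B = "\<lparr>pverts = {x, y}, parcs = {(x, y), (y, x)}\<rparr>"
  have xy: "x \<noteq> y" "x \<in> pverts G" "y \<in> pverts G" "(y, x) \<in> parcs G"
    using assms by (auto dest: no_loops' in_arcsD1 in_arcsD2 arcs_symmetric)
  have B: "pair_graph ?B" by (rule pair_graphI) (use xy in \<open>auto simp: sym_def\<close>)
  then interpret B: pair_graph ?B .
  have "nonseparable ?B"
  proof (rule nonseparableI[OF B])
    fix w
    have "pverts ?B - {w} = {x, y} \<or> pverts ?B - {w} = {x} \<or> pverts ?B - {w} = {y}"
      using xy(1) by auto
    then show "connected_on (parcs ?B) (pverts ?B - {w})" by (auto simp: connected_on_def)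
  qed (auto simp: connected_on_def)
  moreover have "subgraph (with_proj ?B) (with_proj G)"
    using assms xy B.pair_wf_digraph_axioms pair_wf_digraph_axioms by (simp add: subgraph_pair_iff)
  ultimately obtain D where "D \<in> cycles_of G" "subgraph (with_proj ?B) (with_proj D)"
    using in_some_cycle by blast
  moreover from this obtain i where "i < length Cs" "D = Cs ! i" using Cs(2) by (metis in_set_conv_nth)
  ultimately show ?thesis by (auto simp: subgraph_pair_iff)
qed

lemma v_in: "Suc i < length Cs \<Longrightarrow> v i \<in> pverts (Cs ! i) \<and> v i \<in> pverts (Cs ! Suc i)"
  using v by blast

text \<open>A third cycle through \<open>v i\<close> would contradict that a cut vertex lies on
  exactly two cycles.\<close>

lemma v_only:
  assumes "Suc i < length Cs" "k < length Cs" "v i \<in> pverts (Cs ! k)"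
  shows "k = i \<or> k = Suc i"
proof (rule ccontr)
  assume "\<not> ?thesis"
  then have "card {Cs ! i, Cs ! Suc i, Cs ! k} = 3"
    using assms Cs(1) by (simp add: nth_eq_iff_index_eq)
  moreover have "{Cs ! i, Cs ! Suc i, Cs ! k} \<subseteq> {C \<in> cycles_of G. v i \<in> pverts C}"
    using assms v_in Cs_nth(3) by auto
  moreover have two: "card {C \<in> cycles_of G. v i \<in> pverts C} = 2"
    using cactus v[OF assms(1)] by (simp add: chain_cactus_def)
  \<comment> \<open>An infinite set has \<open>card\<close> equal to \<open>0\<close>, so the value
    \<open>2\<close> yields finiteness.\<close>
  moreover have "finite {C \<in> cycles_of G. v i \<in> pverts C}"
    by (rule ccontr) (use two in simp)
  ultimately show False
    using card_mono[of "{C \<in> cycles_of G. v i \<in> pverts C}" "{Cs ! i, Cs ! Suc i, Cs ! k}"] by simp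
qed

text \<open>
  Two non-consecutive cycles with a common vertex would close a ring of cycles. A ring is
  nonseparable, so it lies in a single block, which is a cycle.
\<close>

lemma far_disjoint:
  assumes ij: "i < j" "j < length Cs" "j \<noteq> Suc i"
  shows "pverts (Cs ! i) \<inter> pverts (Cs ! j) = {}"
proof (rule ccontr)
  assume "pverts (Cs ! i) \<inter> pverts (Cs ! j) \<noteq> {}"
  then obtain w where w: "w \<in> pverts (Cs ! i)" "w \<in> pverts (Cs ! j)" by blast
  define H where "H = \<lparr>pverts = (\<Union>k\<in>{i..j}. pverts (Cs ! k)), parcs = (\<Union>k\<in>{i..j}. parcs (Cs ! k))\<rparr>"
  have kn: "k < length Cs" if "k \<in> {i..j}" for k using that ij by auto
  have H_sub: "pverts H \<subseteq> pverts G" "parcs H \<subseteq> parcs G"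
    using sub_Cs[OF kn] by (simp_all add: H_def UN_subset_iff)
  have H: "pair_graph H"
  proof (rule pair_graphI)
    show "finite (pverts H)" using H_sub(1) pair_finite_verts finite_subset by blast
    show "parcs H \<subseteq> pverts H \<times> pverts H"
      using cycle_graph_cyc(3)[OF Cs_nth(1)[OF kn]] unfolding H_def pair_pre_digraph.simps by blast
    show "sym (parcs H)"
      using cycle_graph_cyc(4)[OF Cs_nth(1)[OF kn]]
      unfolding H_def pair_pre_digraph.simps sym_def by blast
    show "(x, x) \<notin> parcs H" for x using H_sub(2) no_loops' by blast
  qed
  have H_connected_on: "connected_on (parcs H) (pverts (Cs ! k))" "connected_on (parcs H) (pverts (Cs ! k) - {x})"
    if k: "k \<in> {i..j}" for k x
  proof -
    have "parcs (Cs ! k) \<subseteq> parcs H" using k by (auto simp: H_def)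
    then show "connected_on (parcs H) (pverts (Cs ! k))" "connected_on (parcs H) (pverts (Cs ! k) - {x})"
      using connected_on_mono cycle_graph_connected_on[OF Cs_nth(1)[OF kn[OF k]]] by blast+
  qed
  \<comment> \<open>\<open>v k\<close> lies only on cycles \<open>k\<close> and
    \<open>k + 1\<close>, which cannot include both \<open>i\<close> and \<open>j\<close>.\<close>
  have w_ne: "w \<noteq> v k" if "k \<in> {i..<j}" for k
    using v_only[of k i] v_only[of k j] w ij that by auto
  \<comment> \<open>A stretch of the chain survives the deletion of \<open>x\<close> as long as
    \<open>x\<close> is none of its inner junctions.\<close>
  have part: "connected_on (parcs H) (\<Union>k\<in>{a..b}. pverts (Cs ! k) - {x})"
    if "i \<le> a" "a \<le> b" "b \<le> j" "\<And>l. a \<le> l \<Longrightarrow> l < b \<Longrightarrow> v l \<noteq> x" for a b x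
  proof (rule connected_on_chain)
    fix l assume "a \<le> l" "l < b"
    then have "v l \<in> pverts (Cs ! l) \<inter> pverts (Cs ! Suc l) - {x}"
      using v_in[of l] that ij by auto
    then show "(pverts (Cs ! l) - {x}) \<inter> (pverts (Cs ! Suc l) - {x}) \<noteq> {}" by blast
  qed (use H_connected_on that in auto)
  have "nonseparable H"
  proof (rule nonseparableI[OF H])
    show "pverts H \<noteq> {}" using w ij by (auto simp: H_def)
    have "connected_on (parcs H) (\<Union>k\<in>{i..j}. pverts (Cs ! k))"
    proof (rule connected_on_chain)
      fix l assume "i \<le> l" "l < j"
      then show "pverts (Cs ! l) \<inter> pverts (Cs ! Suc l) \<noteq> {}" using v[of l] ij by auto
    qed (use H_connected_on ij in auto)
    then show "connected_on (parcs H) (pverts H)" by (simp add: H_def)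
    fix x
    have pH: "pverts H - {x} = (\<Union>k\<in>{i..j}. pverts (Cs ! k) - {x})" by (auto simp: H_def)
    show "connected_on (parcs H) (pverts H - {x})"
    proof (cases "\<exists>k\<in>{i..<j}. v k = x")
      case False
      then show ?thesis unfolding pH using ij by (intro part) auto
    next
      case True
      then obtain k where k: "i \<le> k" "k < j" "v k = x" by auto
      have ne: "v l \<noteq> x" if "l \<noteq> k" "l < j" for l
        using v_only[of l k] v_only[of l "Suc k"] v_in[of k] that k ij by auto
      \<comment> \<open>Deleting the junction \<open>v k\<close> cuts the chain in two, but the
        halves still meet in \<open>w\<close>, which closes the ring.\<close>
      have "connected_on (parcs H) ((\<Union>l\<in>{i..k}. pverts (Cs ! l) - {x}) \<union> (\<Union>l\<in>{Suc k..j}. pverts (Cs ! l) - {x}))"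
      proof (rule connected_on_Un)
        show "connected_on (parcs H) (\<Union>l\<in>{i..k}. pverts (Cs ! l) - {x})"
          using k ne by (intro part) auto
        show "connected_on (parcs H) (\<Union>l\<in>{Suc k..j}. pverts (Cs ! l) - {x})"
          using k ne by (intro part) auto
        show "(\<Union>l\<in>{i..k}. pverts (Cs ! l) - {x}) \<inter> (\<Union>l\<in>{Suc k..j}. pverts (Cs ! l) - {x}) \<noteq> {}"
          using w w_ne[of k] k by fastforce
      qed
      moreover have "{i..j} = {i..k} \<union> {Suc k..j}" using k by auto
      ultimately show ?thesis unfolding pH by (simp only: UN_Un)
    qed
  qed
  moreover have "subgraph (with_proj H) (with_proj G)"
    using H_sub H by (simp add: subgraph_pair_iff pair_wf_digraph_axioms pair_graph_def pair_digraph_def pair_fin_digraph_def)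
  ultimately obtain D where D: "D \<in> cycles_of G" "subgraph (with_proj H) (with_proj D)"
    using in_some_cycle by blast
  \<comment> \<open>Every cycle of the ring shares an edge with \<open>D\<close>, and in a cactus an
    edge determines its cycle; so \<open>Cs ! i\<close> and \<open>Cs ! j\<close> would
    coincide.\<close>
  have "Cs ! k = D" if k: "k \<in> {i..j}" for k
  proof -
    obtain c where "cyclic_labelling (parcs (Cs ! k)) (card (pverts (Cs ! k))) c"
      using cycle_graph_cyc(1)[OF Cs_nth(1)[OF kn[OF k]]] by blast
    then have e: "(c 0, c 1) \<in> parcs (Cs ! k)" using cyc_succ[of _ _ c 0] by simp
    moreover have "parcs (Cs ! k) \<subseteq> parcs H" "parcs H \<subseteq> parcs D"
      using D(2) k by (auto simp: subgraph_pair_iff H_def)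
    ultimately have "(c 0, c 1) \<in> parcs D" by blast
    moreover have "(c 0, c 1) \<in> parcs G" using e sub_Cs(2)[OF kn[OF k]] by blast
    ultimately show ?thesis
      using cactus e D(1) Cs_nth(3)[OF kn[OF k]] unfolding chain_cactus_def cactus_def by blast
  qed
  then have "Cs ! i = Cs ! j" using ij by auto
  then show False using ij Cs(1) by (simp add: nth_eq_iff_index_eq)
qed

section \<open>Aligning consecutive cycles\<close>

lemma common_vertex_unique:
  assumes "k < length Cs" "l < length Cs" "k \<noteq> l" "x \<in> pverts (Cs ! k) \<inter> pverts (Cs ! l)" "y \<in> pverts (Cs ! k) \<inter> pverts (Cs ! l)"
  shows "x = y"
proof -
  have "x = y" if "k < l" "l < length Cs" "x \<in> pverts (Cs ! k) \<inter> pverts (Cs ! l)"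
    "y \<in> pverts (Cs ! k) \<inter> pverts (Cs ! l)" for k l
    using that far_disjoint[of k l] v[of k] by (cases "l = Suc k") auto
  from this[of k l] this[of l k] show ?thesis using assms by (cases "k < l") auto
qed

text \<open>Cycles are induced: an arc coming from another cycle would give two distinct common
  vertices. Hence labellings may refer to the arcs of \<open>G\<close>.\<close>

lemma arc_in_cycle_iff:
  assumes "k < length Cs" "x \<in> pverts (Cs ! k)" "y \<in> pverts (Cs ! k)"
  shows "(x, y) \<in> parcs G \<longleftrightarrow> (x, y) \<in> parcs (Cs ! k)"
proof
  assume xy: "(x, y) \<in> parcs G"
  then obtain l where l: "l < length Cs" "(x, y) \<in> parcs (Cs ! l)" using cover_arcs by blast
  then have "x \<in> pverts (Cs ! l)" "y \<in> pverts (Cs ! l)"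
    using cycle_graph_cyc(3)[OF Cs_nth(1)] by blast+
  then have "k = l" using common_vertex_unique[of k l x y] assms l xy no_loops' by blast
  then show "(x, y) \<in> parcs (Cs ! k)" using l by simp
qed (use sub_Cs(2) assms in blast)

lemma cycle_cyc:
  assumes "k < length Cs"
  shows "\<exists>c. cyclic_labelling (parcs G) (card (pverts (Cs ! k))) c \<and> range c = pverts (Cs ! k)"
proof -
  obtain c where c: "cyclic_labelling (parcs (Cs ! k)) (card (pverts (Cs ! k))) c" "range c = pverts (Cs ! k)"
    using cycle_graph_cyc(1)[OF Cs_nth(1)[OF assms]] by blast
  then have "(c i, c j) \<in> parcs G \<longleftrightarrow> (c i, c j) \<in> parcs (Cs ! k)" for i j
    using arc_in_cycle_iff[OF assms] by blast
  then have "cyclic_labelling (parcs G) (card (pverts (Cs ! k))) c" using c(1) by (simp add: cyclic_labelling_def)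
  then show ?thesis using c(2) by blast
qed

text \<open>An internal cycle has exactly two cut vertices, so they are its two junctions; a
  shortest walk between them has length two and supplies the midpoint.\<close>

lemma meta_position_walk:
  assumes "0 < i" "Suc i < length Cs" "in_position G 2 (Cs ! i)"
  shows "\<exists>m\<in>pverts (Cs ! i). (v (i - 1), m) \<in> parcs G \<and> (m, v i) \<in> parcs G"
    and "v (i - 1) \<noteq> v i"
proof -
  let ?C = "Cs ! i"
  have iN: "i < length Cs" using assms by simp
  note C = cycle_graph_cyc[OF Cs_nth(1)[OF iN]]
  obtain j where j: "i = Suc j" using assms(1) by (cases i) auto
  show ne: "v (i - 1) \<noteq> v i"
    using v_only[of j "Suc i"] v_in[of i] assms j by auto
  obtain a b where ab: "a \<noteq> b" "cut_vertices_in G ?C = {a, b}" "graph_dist ?C a b = 2"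
    using assms(3) by (auto simp: in_position_def)
  have "v (i - 1) \<in> cut_vertices_in G ?C" "v i \<in> cut_vertices_in G ?C"
    using v[of j] v[of i] v_in[of j] v_in[of i] assms j by (auto simp: cut_vertices_in_def)
  then have vab: "(v (i - 1) = a \<and> v i = b) \<or> (v (i - 1) = b \<and> v i = a)"
    using ab ne by auto
  have abC: "a \<in> pverts ?C" "b \<in> pverts ?C" using ab(2) by (auto simp: cut_vertices_in_def)
  interpret C: pair_wf_digraph ?C by unfold_locales (use C(3) in auto)
  have "(a, b) \<in> (parcs ?C \<inter> pverts ?C \<times> pverts ?C)\<^sup>*"
    using cycle_graph_connected_on(1)[OF Cs_nth(1)[OF iN]] abC by (auto simp: connected_on_def)
  then have "a \<rightarrow>\<^sup>*\<^bsub>with_proj ?C\<^esub> b"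
    unfolding reachable_def by (rule rtrancl_on_if_rtrancl) (use abC in auto)
  \<comment> \<open>\<open>graph_dist\<close> is a \<open>LEAST\<close>, so it is attained only once
    some walk is known to exist.\<close>
  then have "\<exists>k p. C.awalk a p b \<and> length p = k"
    by (simp add: C.reachable_awalk)
  from LeastI_ex[OF this] obtain p where p: "C.awalk a p b" "length p = 2"
    using ab(3) unfolding graph_dist_def by auto
  obtain e f where ef: "p = [e, f]" using p(2) by (auto simp: length_Suc_conv numeral_2_eq_2)
  then have ef': "(a, snd e) \<in> parcs ?C" "(snd e, b) \<in> parcs ?C"
    using p(1) by (auto simp: C.awalk_def) (metis prod.collapse)+
  then have m: "snd e \<in> pverts ?C" using C(3) by blast
  have "(a, snd e) \<in> parcs G" "(snd e, b) \<in> parcs G" "(snd e, a) \<in> parcs G" "(b, snd e) \<in> parcs G"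
    using ef' sub_Cs(2)[OF iN] arcs_symmetric by blast+
  then show "\<exists>m\<in>pverts ?C. (v (i - 1), m) \<in> parcs G \<and> (m, v i) \<in> parcs G"
    using vab m by blast
qed

text \<open>A rotation suffices for an end cycle, where at most one label is prescribed; an internal
  cycle needs labels \<open>0\<close> and \<open>2\<close> at once, which meta-position
  allows.\<close>

lemma aligned_cyc:
  assumes h: "\<And>C. C \<in> cycles_of G \<Longrightarrow> card (pverts C) = h"
    and pos: "\<And>i. 0 < i \<Longrightarrow> i < length Cs - 1 \<Longrightarrow> in_position G 2 (Cs ! i)"
    and k: "k < length Cs"
  shows "\<exists>c. cyclic_labelling (parcs G) h c \<and> range c = pverts (Cs ! k) \<and>
    (0 < k \<longrightarrow> c 0 = v (k - 1)) \<and> (Suc k < length Cs \<longrightarrow> c 2 = v k)"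
proof -
  obtain c where c: "cyclic_labelling (parcs G) h c" "range c = pverts (Cs ! k)"
    using cycle_cyc[OF k] h[OF Cs_nth(3)[OF k]] by auto
  have vk: "v k \<in> range c" if "Suc k < length Cs" using v_in that c by auto
  have vk1: "v (k - 1) \<in> range c" if "0 < k" using v_in[of "k - 1"] that c k by auto
  consider "k = 0" "length Cs = 1" | "k = 0" "Suc k < length Cs" | "0 < k" "\<not> Suc k < length Cs" | "0 < k" "Suc k < length Cs"
    using k by linarith
  then show ?thesis
  proof cases
    case 1
    then show ?thesis using c by auto
  next
    case 2
    then show ?thesis using cyc_rotate[OF c(1) vk, of 2] c(2) by auto
  next
    case 3
    then show ?thesis using cyc_rotate[OF c(1) vk1, of 0] c(2) by auto
  next
    case 4
    then have "in_position G 2 (Cs ! k)" by (intro pos) auto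
    note w = meta_position_walk[OF 4 this]
    then obtain m where "m \<in> range c" "(v (k - 1), m) \<in> parcs G" "(m, v k) \<in> parcs G"
      using c by blast
    then show ?thesis
      using cyc_label_distance_two[OF c(1) w(2) vk1 vk, of m] 4 c(2) by auto
  qed
qed

end

section \<open>From meta-chains to the recurrence\<close>

lemma indep_poly_meta_chain:
  assumes "meta_chain h n G" "h \<ge> 4" "n \<ge> 1"
  shows "indep_poly G = fst (meta_transfer h (n - 1)) + snd (meta_transfer h (n - 1))"
proof -
  obtain Cs where hc: "chain_h_cactus h G" "chain_length G = n" "chain_order G Cs"
    and pos: "\<And>i. 0 < i \<Longrightarrow> i < n - 1 \<Longrightarrow> in_position G 2 (Cs ! i)"
    using assms(1) unfolding meta_chain_def by blast
  have len: "length Cs = n"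
    using hc distinct_card[of Cs] by (simp add: chain_length_def chain_order_def)
  have "\<forall>i. \<exists>w. Suc i < length Cs \<longrightarrow> cut_vertex G w \<and> pverts (Cs ! i) \<inter> pverts (Cs ! Suc i) = {w}"
    using hc(3) by (auto simp: chain_order_def)
  then obtain v where v: "\<And>i. Suc i < length Cs \<Longrightarrow> cut_vertex G (v i) \<and> pverts (Cs ! i) \<inter> pverts (Cs ! Suc i) = {v i}"
    by metis
  interpret chain_cactus_cycles G Cs v
  proof
    show "chain_cactus G" using hc(1) by (simp add: chain_h_cactus_def)
    show "distinct Cs" "set Cs = cycles_of G" using hc(3) by (simp_all add: chain_order_def)
  qed (rule v)
  have h: "card (pverts C) = h" if "C \<in> cycles_of G" for C
    using hc(1) that by (simp add: chain_h_cactus_def)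
  have pos': "in_position G 2 (Cs ! i)" if "0 < i" "i < length Cs - 1" for i
    using pos that len by simp
  have "\<exists>c. cyclic_labelling (parcs G) h c \<and> range c = pverts (Cs ! k) \<and>
    (0 < k \<longrightarrow> c 0 = v (k - 1)) \<and> (Suc k < length Cs \<longrightarrow> c 2 = v k)" if "k < length Cs" for k
    by (rule aligned_cyc[OF h pos' that])
  then obtain c where c: "\<And>k. k < length Cs \<Longrightarrow> cyclic_labelling (parcs G) h (c k) \<and> range (c k) = pverts (Cs ! k) \<and>
    (0 < k \<longrightarrow> c k 0 = v (k - 1)) \<and> (Suc k < length Cs \<longrightarrow> c k 2 = v k)"
    by metis
  interpret D: meta_decomposition "parcs G" h "length Cs" c
  proof
    show "sym (parcs G)" using arcs_symmetric by (auto simp: sym_def)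
    show "\<exists>k<length Cs. x \<in> range (c k) \<and> y \<in> range (c k)" if xy: "(x, y) \<in> parcs G" for x y
    proof -
      obtain k where k: "k < length Cs" "(x, y) \<in> parcs (Cs ! k)" using cover_arcs xy by blast
      then have "x \<in> pverts (Cs ! k)" "y \<in> pverts (Cs ! k)"
        using cycle_graph_cyc(3)[OF Cs_nth(1)[OF k(1)]] by blast+
      then show ?thesis using c[OF k(1)] k(1) by blast
    qed
    show "range (c i) \<inter> range (c j) = {}" if "i < j" "j < length Cs" "j \<noteq> Suc i" for i j
      using far_disjoint[OF that] c[of i] c[of j] that by simp
    show "cyclic_labelling (parcs G) h (c k)" if "k < length Cs" for k
      using c[OF that] by blast
    show "range (c k) \<inter> range (c (Suc k)) = {c (Suc k) 0}" "c k 2 = c (Suc k) 0"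
      if k: "Suc k < length Cs" for k
      using c[of k] c[of "Suc k"] v[OF k] k by simp_all
  qed (rule assms(2))
  have "n - 1 < length Cs" using len assms(3) by simp
  have "pverts G = D.W (n - 1)"
  proof
    show "pverts G \<subseteq> D.W (n - 1)"
    proof
      fix x assume "x \<in> pverts G"
      then obtain k where k: "k < length Cs" "x \<in> pverts (Cs ! k)" using cover_verts by blast
      then have "k \<le> n - 1" "x \<in> range (c k)" using len c[OF k(1)] by auto
      then show "x \<in> D.W (n - 1)" unfolding D.W_def by blast
    qed
    show "D.W (n - 1) \<subseteq> pverts G"
    proof
      fix x assume "x \<in> D.W (n - 1)"
      then obtain k where "k \<le> n - 1" "x \<in> range (c k)" unfolding D.W_def by blast
      moreover from this have k: "k < length Cs" using len assms(3) by simp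
      ultimately show "x \<in> pverts G" using c[OF k] sub_Cs(1)[OF k] by blast
    qed
  qed
  then show ?thesis
    using D.indep_poly_on_W[OF \<open>n - 1 < length Cs\<close>] indep_poly_eq_on_verts[OF pair_finite_verts] by simp
qed

theorem theorem6:
  fixes h n :: nat
    and M :: "'a pair_pre_digraph"
    and M' :: "'b pair_pre_digraph"
    and M'' :: "'c pair_pre_digraph"
  assumes "h \<ge> 4" and "n \<ge> 3"
    and "meta_chain h n M"
    and "meta_chain h (n - 1) M'"
    and "meta_chain h (n - 2) M''"
  shows
    "let x = monom 1 1;
         p = path_poly;
         k = int h;
         \<alpha> = x^2 * p (k - 5) + x * (p (k - 4) + 2 * p (k - 5)) + p (k - 4);
         \<beta> = x * (p (k - 5))^2 + (p (k - 5))^2 + p (k - 4) * p (k - 5) - p (k - 4) * p (k - 6)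
     in indep_poly M = \<alpha> * indep_poly M' - x^2 * \<beta> * indep_poly M''"
proof -
  \<comment> \<open>A chain of \<open>n\<close> cycles corresponds to transfer index
    \<open>n - 1\<close>, so the three chains sit at indices \<open>n - 1\<close>,
    \<open>n - 2\<close> and \<open>n - 3\<close>.\<close>
  have "n - 1 = Suc (Suc (n - 3))" "n - 1 - 1 = Suc (n - 3)" "n - 2 - 1 = n - 3"
    using assms(2) by auto
  moreover have "n \<ge> 1" "n - 1 \<ge> 1" "n - 2 \<ge> 1" using assms(2) by auto
  ultimately show ?thesis
    using indep_poly_meta_chain[OF assms(3,1)] indep_poly_meta_chain[OF assms(4,1)]
      indep_poly_meta_chain[OF assms(5,1)] meta_transfer_recurrence[OF assms(1), of "n - 3"]
    by (simp add: Let_def)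
qed

end
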